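(* Let $(X,Y)$ be a random pair in $\mathcal X\times\mathbb R$ with $|Y|\le b$ a.s. for some $b>0$, let $\mathcal D=\{(X_1,Y_1),\dots,(X_n,Y_n)\}$ consist of $n$ i.i.d. copies of $(X,Y)$, and let $\mathcal F=\{f_1,\dots,f_M\}$ be a finite dictionary of deterministic measurable functions $\mathcal X\to\mathbb R$ with $\max_{1\le j\le M}|f_j(X)|\le b$ a.s. Suppose the loss $\ell$ satisfies Assumption 1 with constants $C_b$ and $C_\ell$. Let $\nu\in(0,1)$, let $\pi=(\pi_1,\dots,\pi_M)$ be a prior with $\pi_j>0$ and $\sum_j\pi_j=1$, set $\mu=\min(\nu,1-\nu)\,C_\ell/10$, and let $\beta$ satisfy $$\beta>\max\Big[\frac{12C_b^2(1-\nu)^2}{\mu},\ 6\sqrt3\,bC_b(1-\nu),\ \frac{3C_b\nu(\nu C_b+4\mu b)}{2\mu}\Big].$$ Let $\hat\theta$ be the $Q$-aggregation weight vector defined below. Then for every $x>0$, with probability at least $1-e^{-x}$, $$R(f_{\hat\theta})\le\min_{1\le j\le M}\Big[R(f_j)+\frac{\beta}{n}\log\frac1{\pi_j}\Big]+\frac{2\beta x}{n},$$ and moreover $$\mathbb E\big[R(f_{\hat\theta})\big]\le\min_{1\le j\le M}\Big[R(f_j)+\frac{\beta}{n}\log\frac1{\pi_j}\Big].$$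
   Context: Loss $\ell:\mathbb R^2\to\mathbb R$. For a (possibly data-dependent) function $f:\mathcal X\to\mathbb R$, the risk is $R(f)=\mathbb E[\ell(Y,f(X))\mid\mathcal D]$ (where $(X,Y)$ is independent of $\mathcal D$), and the empirical risk is $R_n(f)=\frac1n\sum_{i=1}^n\ell(Y_i,f(X_i))$. $\Theta=\{\theta\in\mathbb R^M:\theta_j\ge0,\ \sum_{j=1}^M\theta_j=1\}$ and $f_\theta=\sum_{j=1}^M\theta_jf_j$. Assumption 1: for all $f,g\in[-b,b]$, $|\ell(Y,f)-\ell(Y,g)|\le C_b|f-g|$ almost surely; and almost surely the function $\ell(Y,\cdot)$ is strongly convex on $[-b,b]$ with modulus $C_\ell>0$, i.e. $\ell(Y,\alpha a+(1-\alpha)a')\le\alpha\ell(Y,a)+(1-\alpha)\ell(Y,a')-\frac{C_\ell}{2}\alpha(1-\alpha)(a-a')^2$ for all $a,a'\in[-b,b]$, $\alpha\in(0,1)$. $Q$-aggregation: $\hat\theta$ is any (measurable) minimizer over $\Theta$ of $$\theta\mapsto(1-\nu)R_n(f_\theta)+\nu\sum_{j=1}^M\theta_jR_n(f_j)-\frac{\beta}{n}\sum_{j=1}^M\theta_j\log\pi_j .$$ *)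

theory Defs
  imports "HOL-Probability.Probability"
begin

definition risk :: "('x \<times> real) measure \<Rightarrow> (real \<Rightarrow> real \<Rightarrow> real) \<Rightarrow> ('x \<Rightarrow> real) \<Rightarrow> real" where
  "risk P l g = (\<integral>z. l (snd z) (g (fst z)) \<partial>P)"

definition emp_risk :: "(real \<Rightarrow> real \<Rightarrow> real) \<Rightarrow> nat \<Rightarrow> (nat \<Rightarrow> 'x \<times> real) \<Rightarrow> ('x \<Rightarrow> real) \<Rightarrow> real" where
  "emp_risk l n d g = (1 / real n) * (\<Sum>i=1..n. l (snd (d i)) (g (fst (d i))))"

definition weight_simplex :: "nat \<Rightarrow> (nat \<Rightarrow> real) set" where
  "weight_simplex M = {\<theta>. (\<forall>j\<in>{1..M}. 0 \<le> \<theta> j) \<and> (\<Sum>j=1..M. \<theta> j) = 1}"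

definition f_agg :: "(nat \<Rightarrow> 'x \<Rightarrow> real) \<Rightarrow> nat \<Rightarrow> (nat \<Rightarrow> real) \<Rightarrow> 'x \<Rightarrow> real" where
  "f_agg f M \<theta> = (\<lambda>x. \<Sum>j=1..M. \<theta> j * f j x)"

definition Q_obj ::
  "(real \<Rightarrow> real \<Rightarrow> real) \<Rightarrow> (nat \<Rightarrow> 'x \<Rightarrow> real) \<Rightarrow> nat \<Rightarrow> real \<Rightarrow> real \<Rightarrow> (nat \<Rightarrow> real)
    \<Rightarrow> nat \<Rightarrow> (nat \<Rightarrow> 'x \<times> real) \<Rightarrow> (nat \<Rightarrow> real) \<Rightarrow> real" where
  "Q_obj l f M \<nu> \<beta> \<pi> n d \<theta> =
     (1 - \<nu>) * emp_risk l n d (f_agg f M \<theta>)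
     + \<nu> * (\<Sum>j=1..M. \<theta> j * emp_risk l n d (f j))
     - \<beta> / real n * (\<Sum>j=1..M. \<theta> j * ln (\<pi> j))"

definition strongly_convex_on_mod :: "real set \<Rightarrow> real \<Rightarrow> (real \<Rightarrow> real) \<Rightarrow> bool" where
  "strongly_convex_on_mod S c h \<longleftrightarrow>
     (\<forall>a\<in>S. \<forall>a'\<in>S. \<forall>\<alpha>::real. 0 < \<alpha> \<and> \<alpha> < 1 \<longrightarrow>
        h (\<alpha> * a + (1 - \<alpha>) * a') \<le> \<alpha> * h a + (1 - \<alpha>) * h a' - c / 2 * \<alpha> * (1 - \<alpha>) * (a - a')\<^sup>2)"

end

theory Submission
  imports Defs
begin

text \<open>
  Put \<open>\<mu> = min \<nu> (1 - \<nu>) C\<^sub>l / 10\<close>, write \<open>D \<theta> \<eta> = (\<Sum>j. \<theta> j * norm (f j - f_\<eta>)^2)\<close> with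
  \<open>L\<^sup>2(P)\<close> norms and \<open>V \<theta> = D \<theta> \<theta>\<close>, and let \<open>\<eta>\<close> minimise the population version of the
  \<open>Q\<close>-aggregation objective plus \<open>\<mu> V\<close>. This function has quadratic growth at \<open>\<eta>\<close>, so with \<open>A\<close>
  the fluctuation of the objective between \<open>\<theta>hat\<close> and \<open>\<eta>\<close>, and \<open>K\<close> the prior penalty, the excess
  risk is at most \<open>(7/4) A - 3 \<mu> D \<theta>hat \<eta> - (7/4) \<mu> V \<eta> - K \<theta>hat\<close>.

  \<open>A\<close> is the sum of the fluctuation of the aggregate losses and of a part linear in the weights.
  Convexity of \<open>exp\<close> (weights 5/12 and 7/12) separates them. For the linear part the exponential
  of a convex combination is at most a sum over the dictionary, and Bernstein's inequality applies.
  The other part becomes linear after symmetrization and contraction, which are carried out one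
  observation at a time; each step contributes a hyperbolic cosine of \<open>f j - f_\<eta>\<close>. Altogether the exponential moment of \<open>n / \<beta>\<close> times the excess
  risk is at most 1, and both claims follow by Markov's inequality and \<open>exp u \<ge> 1 + u\<close>.
\<close>

section \<open>Symmetrization and contraction\<close>

text \<open>The reference \<open>\<eta>\<close> is deterministic so that both exponential moments
  concern increments from a fixed point, with variances of \<open>f j - f_\<eta>\<close>. The term
  \<open>\<mu> V\<close> has two purposes. It vanishes at the vertices, so the minimal value is
  still at most every penalized dictionary risk. At \<open>\<eta>\<close> it leaves a negative
  multiple of \<open>V \<eta>\<close>, which is needed because the Bernstein variance of a
  dictionary element against the mixture \<open>\<eta>\<close> is of order
  \<open>D + V \<eta>\<close>. The cost is that \<open>V\<close> is concave along segments; the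
  choice of \<open>\<mu>\<close> lets strong convexity of the risk outweigh this. The weights 5/12
  and 7/12 are forced: both parts may spend \<open>3 \<mu> D\<close>, but only the linear part
  spends \<open>V \<eta>\<close>, again at rate \<open>3 \<mu>\<close>, and
  \<open>7/4 = 3 * 7/12\<close>. The obstacle is that \<open>\<theta>hat\<close> depends on the data
  while the loss is nonlinear in the weights, so suprema of exponentials have to be integrated, with
  prior and variance corrections inside the exponent. Hence contraction is proved for the
  exponential itself and with an arbitrary offset.\<close>

lemma exp_increment_mono:
  fixes a a' d d' :: real
  assumes "a \<le> a'" "0 \<le> d" "d \<le> d'"
  shows "exp (a + d) - exp a \<le> exp (a' + d') - exp a'"
proof -
  have "exp a * (exp d - 1) \<le> exp a' * (exp d' - 1)"
    using assms by (intro mult_mono) auto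
  thus ?thesis by (simp add: exp_add algebra_simps)
qed

lemma exp_plus_exp_minus_mono:
  fixes B y w :: real
  assumes "\<bar>y\<bar> \<le> \<bar>w\<bar>"
  shows "exp (B + y) + exp (B - y) \<le> exp (B + w) + exp (B - w)"
proof -
  have "exp ((B - \<bar>w\<bar>) + (\<bar>w\<bar> - \<bar>y\<bar>)) - exp (B - \<bar>w\<bar>)
      \<le> exp ((B + \<bar>y\<bar>) + (\<bar>w\<bar> - \<bar>y\<bar>)) - exp (B + \<bar>y\<bar>)"
    using assms by (intro exp_increment_mono) auto
  thus ?thesis by (auto simp: abs_if split: if_splits)
qed

text \<open>Two increments of exp are compared. If \<open>w \<le> v\<close>, the step from
  \<open>B - w\<close> to \<open>B - y\<close> is no longer than the step from \<open>A + x\<close>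
  to \<open>A + v\<close> and starts lower. If \<open>v < w\<close>, the step from
  \<open>A - v\<close> to \<open>A + x\<close> is compared in the same way with the one from
  \<open>B - y\<close> to \<open>B + w\<close>.\<close>

lemma exp_contraction_pair_nonneg:
  fixes A B x y v w p q :: real
  assumes "\<bar>x\<bar> \<le> \<bar>v\<bar>" "\<bar>y\<bar> \<le> \<bar>w\<bar>" "\<bar>x - y\<bar> \<le> \<bar>v - w\<bar>"
    and "B + y \<le> A + x" "A - x \<le> B - y"
    and "0 \<le> v" "0 \<le> w"
    and "exp (A + v) \<le> p" "exp (B + w) \<le> p" "exp (A - v) \<le> q" "exp (B - w) \<le> q"
  shows "exp (A + x) + exp (B - y) \<le> p + q"
proof (cases "w \<le> v")
  case True
  have "exp ((B - w) + (w - y)) - exp (B - w) \<le> exp ((A + x) + (v - x)) - exp (A + x)"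
    using assms True by (intro exp_increment_mono) auto
  with assms show ?thesis by simp
next
  case False
  have "exp ((A - v) + (x + v)) - exp (A - v) \<le> exp ((B - y) + (w + y)) - exp (B - y)"
    using assms False by (intro exp_increment_mono) auto
  with assms show ?thesis by (simp add: algebra_simps)
qed

text \<open>The two-point core of the Ledoux-Talagrand comparison argument. \<open>A\<close>,
  \<open>x\<close>, \<open>v\<close> belong to a candidate for the sign +, and \<open>B\<close>,
  \<open>y\<close>, \<open>w\<close> to one for the sign -. The numbers \<open>p\<close> and
  \<open>q\<close> stand for the suprema after contraction, so each dominates both
  candidates.\<close>

lemma exp_contraction_pair:
  fixes A B x y v w p q :: real
  assumes le: "\<bar>x\<bar> \<le> \<bar>v\<bar>" "\<bar>y\<bar> \<le> \<bar>w\<bar>" "\<bar>x - y\<bar> \<le> \<bar>v - w\<bar>"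
    and pq: "exp (A + v) \<le> p" "exp (B + w) \<le> p" "exp (A - v) \<le> q" "exp (B - w) \<le> q"
  shows "exp (A + x) + exp (B - y) \<le> p + q"
proof -
  \<comment> \<open>In the first two cases one candidate is better for both signs and a one-point
    comparison suffices. Only the third case compares two different points.\<close>
  consider "A + x < B + y" | "B - y < A - x" | "B + y \<le> A + x" "A - x \<le> B - y" by linarith
  thus ?thesis
  proof cases
    case 1
    hence "exp (A + x) \<le> exp (B + y)" by simp
    with exp_plus_exp_minus_mono[OF le(2), of B] pq show ?thesis by linarith
  next
    case 2
    hence "exp (B - y) \<le> exp (A - x)" by simp
    with exp_plus_exp_minus_mono[OF le(1), of A] pq show ?thesis by linarith
  next
    case 3
    consider "0 \<le> v" "0 \<le> w" | "v \<le> 0" "w \<le> 0" | "0 \<le> v" "w \<le> 0" | "v \<le> 0" "0 \<le> w" by linarith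
    thus ?thesis
    proof cases
      case 1
      with 3 assms show ?thesis by (intro exp_contraction_pair_nonneg[of x v y w B A p q]) auto
    next
      case 2
      have "exp (B + - y) + exp (A - - x) \<le> q + p"
        using 2 3 assms by (intro exp_contraction_pair_nonneg[of "-y" "-w" "-x" "-v" A B q p]) auto
      thus ?thesis by simp
    next
      case a: 3
      with le have "exp (A + x) \<le> exp (A + v)" "exp (B - y) \<le> exp (B - w)" by auto
      with pq show ?thesis by linarith
    next
      case 4
      with le have "exp (A + x) \<le> exp (A - v)" "exp (B - y) \<le> exp (B + w)" by auto
      with pq show ?thesis by linarith
    qed
  qed
qed

lemma SUP_add_SUP_le_ennreal:
  fixes X :: "'i \<Rightarrow> ennreal" and Y :: "'j \<Rightarrow> ennreal"
  assumes "I \<noteq> {}" "J \<noteq> {}" "\<And>i j. i \<in> I \<Longrightarrow> j \<in> J \<Longrightarrow> X i + Y j \<le> c"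
  shows "(SUP i\<in>I. X i) + (SUP j\<in>J. Y j) \<le> c"
proof -
  have "(SUP i\<in>I. X i) + (SUP j\<in>J. Y j) = (SUP i\<in>I. X i + (SUP j\<in>J. Y j))"
    using assms(1) by (simp add: ennreal_SUP_add_left)
  also have "\<dots> = (SUP i\<in>I. SUP j\<in>J. X i + Y j)"
    using assms(2) by (simp add: ennreal_SUP_add_right)
  also have "\<dots> \<le> c" by (intro SUP_least assms)
  finally show ?thesis .
qed

text \<open>Half of each side is a mean over one Rademacher sign. The offset \<open>a\<close> will
  carry the linear part and all observations not being treated, which makes the estimate
  iterable.\<close>

lemma SUP_exp_contraction:
  fixes a x v :: "'t \<Rightarrow> real"
  assumes le: "\<And>t. t \<in> T \<Longrightarrow> \<bar>x t\<bar> \<le> \<bar>v t\<bar>"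
    and lip: "\<And>s t. s \<in> T \<Longrightarrow> t \<in> T \<Longrightarrow> \<bar>x s - x t\<bar> \<le> \<bar>v s - v t\<bar>"
  shows "(SUP t\<in>T. ennreal (exp (a t + x t))) + (SUP t\<in>T. ennreal (exp (a t - x t)))
       \<le> (SUP t\<in>T. ennreal (exp (a t + v t))) + (SUP t\<in>T. ennreal (exp (a t - v t)))"
    (is "_ \<le> ?p + ?q")
proof (cases "T = {} \<or> ?p + ?q = \<top>")
  case True
  thus ?thesis
  proof
    assume "?p + ?q = \<top>"
    thus ?thesis by (rule ssubst) (rule top_greatest)
  qed auto
next
  case False
  hence "?p \<noteq> \<top>" "?q \<noteq> \<top>" unfolding ennreal_add_eq_top de_Morgan_disj by blast+
  then obtain p q where pq: "?p = ennreal p" "0 \<le> p" "?q = ennreal q" "0 \<le> q"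
    by (meson ennreal_cases)
  have p: "exp (a t + v t) \<le> p" if "t \<in> T" for t
  proof -
    have "ennreal (exp (a t + v t)) \<le> ?p" by (rule SUP_upper) (rule that)
    thus ?thesis unfolding pq(1) using pq(2) by (simp only: ennreal_le_iff)
  qed
  have q: "exp (a t - v t) \<le> q" if "t \<in> T" for t
  proof -
    have "ennreal (exp (a t - v t)) \<le> ?q" by (rule SUP_upper) (rule that)
    thus ?thesis unfolding pq(3) using pq(4) by (simp only: ennreal_le_iff)
  qed
  show ?thesis
  proof (rule SUP_add_SUP_le_ennreal)
    fix s t assume st: "s \<in> T" "t \<in> T"
    have "exp (a s + x s) + exp (a t - x t) \<le> p + q"
      using st by (intro exp_contraction_pair[of _ "v s" _ "v t"] le lip p q)
    thus "ennreal (exp (a s + x s)) + ennreal (exp (a t - x t)) \<le> ?p + ?q"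
      unfolding pq using pq by (simp flip: ennreal_plus)
  qed (use False in auto)
qed

text \<open>Jensen's inequality without integrability of \<open>exp g\<close>; if that fails, the
  right side is infinite.\<close>

lemma (in prob_space) exp_expectation_le_nn_integral:
  fixes g :: "'a \<Rightarrow> real"
  assumes g: "integrable M g"
  shows "ennreal (exp (expectation g)) \<le> (\<integral>\<^sup>+ z. ennreal (exp (g z)) \<partial>M)"
proof (cases "integrable M (\<lambda>z. exp (g z))")
  case True
  have "exp (expectation g) \<le> expectation (\<lambda>z. exp (g z))"
    using g True exp_convex by (intro jensens_inequality[where I = UNIV]) auto
  thus ?thesis using True by (subst nn_integral_eq_integral) (auto intro: ennreal_leI)
next
  case False
  have "\<not> (\<integral>\<^sup>+ z. ennreal (exp (g z)) \<partial>M) < \<infinity>"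
    using False g by (simp add: integrable_iff_bounded)
  hence "(\<integral>\<^sup>+ z. ennreal (exp (g z)) \<partial>M) = \<top>"
    by (metis infinity_ennreal_def less_top)
  thus ?thesis by (simp only: top_greatest)
qed

text \<open>Convexity with weights 1/2 separates the expectation from the observation and turns
  \<open>c\<close> into \<open>2 * c\<close>. Jensen then replaces the expectation by an independent
  copy. As the copy has the same law, the two resulting suprema can be integrated over a single
  \<open>z\<close>, where their average acts as a mean over a sign and contraction applies
  pointwise.\<close>

lemma (in prob_space) symmetrization_contraction_step:
  fixes a :: "'t \<Rightarrow> real" and g v :: "'t \<Rightarrow> 'a \<Rightarrow> real" and c :: real
  assumes T: "countable T"
    and g: "\<And>t. t \<in> T \<Longrightarrow> integrable M (g t)"
    and v[measurable]: "\<And>t. t \<in> T \<Longrightarrow> v t \<in> borel_measurable M"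
    and gv: "AE z in M. (\<forall>t\<in>T. \<bar>g t z\<bar> \<le> \<bar>v t z\<bar>) \<and> (\<forall>s\<in>T. \<forall>t\<in>T. \<bar>g s z - g t z\<bar> \<le> \<bar>v s z - v t z\<bar>)"
  shows "(\<integral>\<^sup>+ z. (SUP t\<in>T. ennreal (exp (a t + c * (expectation (g t) - g t z)))) \<partial>M)
       \<le> (\<integral>\<^sup>+ z. (SUP t\<in>T. ennreal (exp (a t + 2 * c * v t z))) / 2
              + (SUP t\<in>T. ennreal (exp (a t - 2 * c * v t z))) / 2 \<partial>M)"
proof -
  have [measurable]: "g t \<in> borel_measurable M" if "t \<in> T" for t using g[OF that] by simp
  note [measurable] = T
  let ?S = "\<lambda>z. SUP t\<in>T. ennreal (exp (a t + 2 * c * g t z))"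
  let ?S' = "\<lambda>z. SUP t\<in>T. ennreal (exp (a t - 2 * c * g t z))"
  have [measurable]: "?S \<in> borel_measurable M" "?S' \<in> borel_measurable M"
    using T by (auto intro!: borel_measurable_SUP)
  have "ennreal (exp (a t + c * (expectation (g t) - g t z))) \<le> (\<integral>\<^sup>+ z. ?S z \<partial>M) / 2 + ?S' z / 2"
    if "t \<in> T" for t z
  proof -
    have "exp ((1 - 1/2) * (a t + 2 * c * expectation (g t)) + (1/2) * (a t - 2 * c * g t z))
        \<le> (1 - 1/2) * exp (a t + 2 * c * expectation (g t)) + (1/2) * exp (a t - 2 * c * g t z)"
      using convex_onD[OF exp_convex, of "1/2" "a t + 2 * c * expectation (g t)" "a t - 2 * c * g t z"]
      by simp
    also have "(1 - 1/2) * (a t + 2 * c * expectation (g t)) + (1/2) * (a t - 2 * c * g t z)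
      = a t + c * (expectation (g t) - g t z)" by (simp add: field_simps)
    finally have "ennreal (exp (a t + c * (expectation (g t) - g t z)))
      \<le> ennreal (exp (a t + 2 * c * expectation (g t)) / 2 + exp (a t - 2 * c * g t z) / 2)"
      by (intro ennreal_leI) simp
    also have "\<dots> = ennreal (exp (a t + 2 * c * expectation (g t))) / 2 + ennreal (exp (a t - 2 * c * g t z)) / 2"
      by (simp add: ennreal_plus divide_ennreal flip: ennreal_numeral)
    also have "ennreal (exp (a t + 2 * c * expectation (g t))) = ennreal (exp (expectation (\<lambda>z. a t + 2 * c * g t z)))"
      using g[OF that] by (simp add: prob_space)
    also have "\<dots> \<le> (\<integral>\<^sup>+ z. ennreal (exp (a t + 2 * c * g t z)) \<partial>M)"
      using g[OF that] by (intro exp_expectation_le_nn_integral) auto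
    also have "\<dots> \<le> (\<integral>\<^sup>+ z. ?S z \<partial>M)"
      by (intro nn_integral_mono SUP_upper that)
    also have "ennreal (exp (a t - 2 * c * g t z)) \<le> ?S' z"
      by (intro SUP_upper that)
    finally show ?thesis by (simp add: divide_right_mono_ennreal add_mono)
  qed
  hence "(\<integral>\<^sup>+ z. (SUP t\<in>T. ennreal (exp (a t + c * (expectation (g t) - g t z)))) \<partial>M)
      \<le> (\<integral>\<^sup>+ z. (\<integral>\<^sup>+ z. ?S z \<partial>M) / 2 + ?S' z / 2 \<partial>M)"
    by (intro nn_integral_mono SUP_least)
  also have "\<dots> = (\<integral>\<^sup>+ z. ?S z / 2 + ?S' z / 2 \<partial>M)"
    by (simp add: nn_integral_add nn_integral_divide emeasure_space_1)
  also have "\<dots> \<le> (\<integral>\<^sup>+ z. (SUP t\<in>T. ennreal (exp (a t + 2 * c * v t z))) / 2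
              + (SUP t\<in>T. ennreal (exp (a t - 2 * c * v t z))) / 2 \<partial>M)"
  proof (rule nn_integral_mono_AE)
    show "AE z in M. ?S z / 2 + ?S' z / 2 \<le> (SUP t\<in>T. ennreal (exp (a t + 2 * c * v t z))) / 2
              + (SUP t\<in>T. ennreal (exp (a t - 2 * c * v t z))) / 2"
      using gv
    proof eventually_elim
      case (elim z)
      have "\<bar>2 * c * g s z - 2 * c * g t z\<bar> \<le> \<bar>2 * c * v s z - 2 * c * v t z\<bar>" if "s \<in> T" "t \<in> T" for s t
        using that elim by (simp add: abs_mult mult_left_mono flip: right_diff_distrib)
      hence "?S z + ?S' z \<le> (SUP t\<in>T. ennreal (exp (a t + 2 * c * v t z)))
              + (SUP t\<in>T. ennreal (exp (a t - 2 * c * v t z)))"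
        using elim by (intro SUP_exp_contraction) (auto simp: abs_mult intro!: mult_left_mono)
      thus ?case by (simp add: divide_right_mono_ennreal flip: add_divide_distrib_ennreal)
    qed
  qed
  finally show ?thesis .
qed

text \<open>This moves from all weight vectors to the vertices. The sum over the dictionary that it
  costs is later absorbed by the prior.\<close>

lemma exp_convex_combination_le_sum:
  fixes t y :: "'j \<Rightarrow> real"
  assumes "finite J" "\<And>j. j \<in> J \<Longrightarrow> 0 \<le> t j" "(\<Sum>j\<in>J. t j) = 1"
  shows "exp (\<Sum>j\<in>J. t j * y j) \<le> (\<Sum>j\<in>J. exp (y j))"
proof -
  have "J \<noteq> {}" using assms by auto
  have "exp (\<Sum>j\<in>J. t j *\<^sub>R y j) \<le> (\<Sum>j\<in>J. t j * exp (y j))"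
    using assms \<open>J \<noteq> {}\<close> exp_convex by (intro convex_on_sum[where C = UNIV]) auto
  also have "\<dots> \<le> (\<Sum>j\<in>J. 1 * exp (y j))"
  proof (intro sum_mono mult_right_mono)
    fix j assume "j \<in> J"
    thus "t j \<le> 1" using member_le_sum[of j J t] assms by auto
  qed auto
  finally show ?thesis by simp
qed

text \<open>Induction on the observations with \<open>y\<close> generalized. Since the majorant is
  linear in the weights, the contraction of one observation merely changes \<open>y j\<close> into
  \<open>y j + 2 * c * h j z\<close> or \<open>y j - 2 * c * h j z\<close>. Averaging the two
  induction hypotheses produces the factor \<open>cosh\<close>.\<close>

lemma (in prob_space) symmetrization_contraction_PiM:
  fixes T :: "('j \<Rightarrow> real) set" and g :: "('j \<Rightarrow> real) \<Rightarrow> 'a \<Rightarrow> real" and h :: "'j \<Rightarrow> 'a \<Rightarrow> real"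
    and y :: "'j \<Rightarrow> real" and c :: real and I :: "'i set"
  assumes T: "countable T" "\<And>t j. t \<in> T \<Longrightarrow> j \<in> J \<Longrightarrow> 0 \<le> t j" "\<And>t. t \<in> T \<Longrightarrow> (\<Sum>j\<in>J. t j) = 1"
    and J: "finite J"
    and g: "\<And>t. t \<in> T \<Longrightarrow> integrable M (g t)"
    and h: "\<And>j. j \<in> J \<Longrightarrow> h j \<in> borel_measurable M"
    and gh: "AE z in M. (\<forall>t\<in>T. \<bar>g t z\<bar> \<le> \<bar>\<Sum>j\<in>J. t j * h j z\<bar>) \<and>
           (\<forall>s\<in>T. \<forall>t\<in>T. \<bar>g s z - g t z\<bar> \<le> \<bar>(\<Sum>j\<in>J. s j * h j z) - (\<Sum>j\<in>J. t j * h j z)\<bar>)"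
    and I: "finite I"
  shows "(\<integral>\<^sup>+ z. (SUP t\<in>T. ennreal (exp ((\<Sum>j\<in>J. t j * y j)
             + c * (\<Sum>i\<in>I. expectation (g t) - g t (z i))))) \<partial>(PiM I (\<lambda>_. M)))
       \<le> (\<Sum>j\<in>J. ennreal (exp (y j)) * (\<integral>\<^sup>+ z. ennreal (cosh (2 * c * h j z)) \<partial>M) ^ card I)"
  using I
proof (induction I arbitrary: y rule: finite_induct)
  case empty
  interpret PiM: prob_space "PiM ({}::'i set) (\<lambda>_. M)" by (rule prob_space_PiM) (rule prob_space_axioms)
  have "(SUP t\<in>T. ennreal (exp (\<Sum>j\<in>J. t j * y j))) \<le> (\<Sum>j\<in>J. ennreal (exp (y j)))"
    using T J by (intro SUP_least) (auto intro!: ennreal_leI exp_convex_combination_le_sum)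
  thus ?case by (simp add: PiM.emeasure_space_1 del: sum_ennreal)
next
  case (insert i I)
  interpret product_sigma_finite "\<lambda>_::'i. M"
    by standard
  have gm[measurable]: "g t \<in> borel_measurable M" if "t \<in> T" for t using g[OF that] by simp
  note [measurable] = h
  let ?rho = "\<lambda>j. \<integral>\<^sup>+ z. ennreal (cosh (2 * c * h j z)) \<partial>M"
  let ?a = "\<lambda>y t x. (\<Sum>j\<in>J. t j * y j) + c * (\<Sum>i\<in>I. expectation (g t) - g t (x i))"
  let ?v = "\<lambda>t z. \<Sum>j\<in>J. t j * h j z"
  let ?Psi = "\<lambda>x. (SUP t\<in>T. ennreal (exp (?a y t x + 2 * c * ?v t (x i)))) / 2
            + (SUP t\<in>T. ennreal (exp (?a y t x - 2 * c * ?v t (x i)))) / 2"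
  let ?Phi = "\<lambda>x. SUP t\<in>T. ennreal (exp (?a y t x + c * (expectation (g t) - g t (x i))))"
  let ?P = "PiM (insert i I) (\<lambda>_. M)"
  have comp: "(\<lambda>x. x k) \<in> measurable ?P M" if "k \<in> insert i I" for k
    using that by measurable
  have m1: "(\<lambda>x. g t (x k)) \<in> borel_measurable ?P" if "k \<in> insert i I" "t \<in> T" for k t
    using measurable_compose[OF comp gm] that by blast
  have m2: "(\<lambda>x. h j (x k)) \<in> borel_measurable ?P" if "k \<in> insert i I" "j \<in> J" for k j
    using measurable_compose[OF comp h] that by blast
  have Phi[measurable]: "?Phi \<in> borel_measurable ?P"
    using T(1) by (intro borel_measurable_SUP) (auto intro!: borel_measurable_add borel_measurable_times
       borel_measurable_sum borel_measurable_diff m1 measurable_compose[OF _ borel_measurable_exp]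
       measurable_compose[OF _ measurable_ennreal])
  have Psi[measurable]: "?Psi \<in> borel_measurable ?P"
    using T(1) by (intro borel_measurable_add borel_measurable_divide_ennreal borel_measurable_const borel_measurable_SUP)
      (auto intro!: borel_measurable_add borel_measurable_times
       borel_measurable_sum borel_measurable_diff m1 m2 measurable_compose[OF _ borel_measurable_exp]
       measurable_compose[OF _ measurable_ennreal])
  have upd: "?a y t (x(i := z)) = ?a y t x" for y t x z
    using insert(2) by (intro arg_cong2[where f = "(+)"] arg_cong2[where f = "(*)"] sum.cong refl) auto
  have "(\<integral>\<^sup>+ z. (SUP t\<in>T. ennreal (exp ((\<Sum>j\<in>J. t j * y j)
             + c * (\<Sum>i\<in>insert i I. expectation (g t) - g t (z i))))) \<partial>?P) = (\<integral>\<^sup>+ x. ?Phi x \<partial>?P)"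
    using insert by (intro nn_integral_cong SUP_cong arg_cong[where f = ennreal]) (auto simp: algebra_simps)
  also have "\<dots> = (\<integral>\<^sup>+ x. (\<integral>\<^sup>+ z. ?Phi (x(i := z)) \<partial>M) \<partial>(PiM I (\<lambda>_. M)))"
    using insert by (intro product_nn_integral_insert Phi) auto
  also have "\<dots> \<le> (\<integral>\<^sup>+ x. (\<integral>\<^sup>+ z. ?Psi (x(i := z)) \<partial>M) \<partial>(PiM I (\<lambda>_. M)))"
    unfolding upd fun_upd_same
    by (intro nn_integral_mono symmetrization_contraction_step T g gh borel_measurable_sum
         borel_measurable_times borel_measurable_const h)
  also have "\<dots> = (\<integral>\<^sup>+ x. ?Psi x \<partial>?P)"
    using insert by (intro product_nn_integral_insert[symmetric] Psi) auto
  \<comment> \<open>The order of integration is exchanged: the contraction step needed the old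
    coordinates fixed, whereas the induction hypothesis integrates them with the new coordinate
    fixed.\<close>
  also have "\<dots> = (\<integral>\<^sup>+ z. (\<integral>\<^sup>+ x. ?Psi (x(i := z)) \<partial>(PiM I (\<lambda>_. M))) \<partial>M)"
    using insert by (intro product_nn_integral_insert_rev Psi) auto
  also have "\<dots> \<le> (\<integral>\<^sup>+ z. (\<Sum>j\<in>J. ennreal (exp (y j)) * ennreal (cosh (2 * c * h j z)) * ?rho j ^ card I) \<partial>M)"
  proof (intro nn_integral_mono)
    fix z
    have m1: "(\<lambda>x. g t (x k)) \<in> borel_measurable (PiM I (\<lambda>_. M))" if "k \<in> I" "t \<in> T" for k t
    proof -
      have "(\<lambda>x. x k) \<in> measurable (PiM I (\<lambda>_. M)) M" using that by measurable
      from measurable_compose[OF this gm] that show ?thesis by blast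
    qed
    have m: "(\<lambda>x. SUP t\<in>T. ennreal (exp (?a y t x))) \<in> borel_measurable (PiM I (\<lambda>_. M))" for y
      using T(1) by (intro borel_measurable_SUP) (auto intro!: borel_measurable_add borel_measurable_times
       borel_measurable_sum borel_measurable_diff m1 measurable_compose[OF _ borel_measurable_exp]
       measurable_compose[OF _ measurable_ennreal])
    have lin: "?a y t x + 2 * c * ?v t z = ?a (\<lambda>j. y j + 2 * c * h j z) t x"
              "?a y t x - 2 * c * ?v t z = ?a (\<lambda>j. y j - 2 * c * h j z) t x" for t x
      by (simp_all add: algebra_simps sum.distrib sum_subtractf sum_distrib_left)
    have "(\<integral>\<^sup>+ x. ?Psi (x(i := z)) \<partial>(PiM I (\<lambda>_. M)))
      = (\<integral>\<^sup>+ x. (SUP t\<in>T. ennreal (exp (?a (\<lambda>j. y j + 2 * c * h j z) t x))) \<partial>(PiM I (\<lambda>_. M))) / 2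
      + (\<integral>\<^sup>+ x. (SUP t\<in>T. ennreal (exp (?a (\<lambda>j. y j - 2 * c * h j z) t x))) \<partial>(PiM I (\<lambda>_. M))) / 2"
      unfolding upd fun_upd_same lin using m by (simp add: nn_integral_add nn_integral_divide)
    also have "\<dots> \<le> (\<Sum>j\<in>J. ennreal (exp (y j + 2 * c * h j z)) * ?rho j ^ card I) / 2
         + (\<Sum>j\<in>J. ennreal (exp (y j - 2 * c * h j z)) * ?rho j ^ card I) / 2"
      by (intro add_mono divide_right_mono_ennreal insert.IH)
    also have "\<dots> = (\<Sum>j\<in>J. (ennreal (exp (y j + 2 * c * h j z)) + ennreal (exp (y j - 2 * c * h j z))) / 2 * ?rho j ^ card I)"
      unfolding divide_ennreal_def distrib_right sum.distrib sum_distrib_right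
      by (simp add: mult_ac)
    also have "\<dots> = (\<Sum>j\<in>J. ennreal (exp (y j)) * ennreal (cosh (2 * c * h j z)) * ?rho j ^ card I)"
    proof (intro sum.cong refl arg_cong2[where f = "(*)"])
      fix j
      have "(ennreal (exp (y j + 2 * c * h j z)) + ennreal (exp (y j - 2 * c * h j z))) / 2
        = ennreal ((exp (y j + 2 * c * h j z) + exp (y j - 2 * c * h j z)) / 2)"
        by (simp add: divide_ennreal flip: ennreal_plus ennreal_numeral)
      also have "(exp (y j + 2 * c * h j z) + exp (y j - 2 * c * h j z)) / 2 = exp (y j) * cosh (2 * c * h j z)"
        by (simp add: cosh_def exp_add exp_diff exp_minus field_simps)
      finally show "(ennreal (exp (y j + 2 * c * h j z)) + ennreal (exp (y j - 2 * c * h j z))) / 2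
        = ennreal (exp (y j)) * ennreal (cosh (2 * c * h j z))"
        by (simp add: ennreal_mult)
    qed
    finally show "(\<integral>\<^sup>+ x. ?Psi (x(i := z)) \<partial>(PiM I (\<lambda>_. M)))
      \<le> (\<Sum>j\<in>J. ennreal (exp (y j)) * ennreal (cosh (2 * c * h j z)) * ?rho j ^ card I)" .
  qed
  also have "\<dots> = (\<Sum>j\<in>J. ennreal (exp (y j)) * ?rho j * ?rho j ^ card I)"
    by (simp add: cosh_def nn_integral_sum nn_integral_cmult nn_integral_multc)
  also have "\<dots> = (\<Sum>j\<in>J. ennreal (exp (y j)) * ?rho j ^ card (insert i I))"
    using insert by (simp add: mult_ac)
  finally show ?case .
qed

section \<open>Risks of aggregates\<close>

lemma f_agg_combine:
  "f_agg F M (\<lambda>j. a * \<theta> j + c * \<eta> j) z = a * f_agg F M \<theta> z + c * f_agg F M \<eta> z"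
  by (simp add: f_agg_def algebra_simps sum.distrib sum_distrib_left)

lemma weight_simplex_combine:
  assumes "\<theta> \<in> weight_simplex M" "\<eta> \<in> weight_simplex M" "0 \<le> a" "a \<le> 1"
  shows "(\<lambda>j. a * \<theta> j + (1 - a) * \<eta> j) \<in> weight_simplex M"
proof -
  have "(\<Sum>j=1..M. a * \<theta> j + (1 - a) * \<eta> j) = a * (\<Sum>j=1..M. \<theta> j) + (1 - a) * (\<Sum>j=1..M. \<eta> j)"
    by (simp add: sum.distrib sum_distrib_left)
  with assms show ?thesis by (auto simp: weight_simplex_def)
qed

lemma weight_simplex_vertex: "j \<in> {1..M} \<Longrightarrow> indicator {j} \<in> weight_simplex M"
  by (simp add: weight_simplex_def indicator_def)

lemma sum_vertex:
  fixes w :: "nat \<Rightarrow> real"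
  assumes "j \<in> {1..M}"
  shows "(\<Sum>i=1..M. indicator {j} i * w i) = w j"
  using assms by (simp add: indicator_def if_distrib[of "\<lambda>x. x * _"] cong: if_cong)

lemma f_agg_vertex: "j \<in> {1..M} \<Longrightarrow> f_agg F M (indicator {j}) z = F j z"
  unfolding f_agg_def by (rule sum_vertex)

lemma weight_simplex_mean_bound:
  fixes w :: "nat \<Rightarrow> real"
  assumes "\<theta> \<in> weight_simplex M" "\<And>j. j \<in> {1..M} \<Longrightarrow> \<bar>w j\<bar> \<le> B"
  shows "\<bar>\<Sum>j=1..M. \<theta> j * w j\<bar> \<le> B"
proof -
  have "\<bar>\<Sum>j=1..M. \<theta> j * w j\<bar> \<le> (\<Sum>j=1..M. \<theta> j * B)"
    using assms by (intro order_trans[OF sum_abs] sum_mono)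
      (auto simp: abs_mult weight_simplex_def intro!: mult_left_mono)
  thus ?thesis using assms by (simp add: weight_simplex_def flip: sum_distrib_right)
qed

text \<open>Bias-variance decomposition for an index drawn from \<open>\<theta>\<close>.\<close>

lemma weight_simplex_mean_square:
  fixes w :: "nat \<Rightarrow> real"
  assumes "\<theta> \<in> weight_simplex M"
  shows "(\<Sum>j=1..M. \<theta> j * (w j - c)\<^sup>2)
    = (\<Sum>j=1..M. \<theta> j * (w j - (\<Sum>j=1..M. \<theta> j * w j))\<^sup>2) + ((\<Sum>j=1..M. \<theta> j * w j) - c)\<^sup>2"
proof -
  let ?m = "\<Sum>j=1..M. \<theta> j * w j"
  have s: "(\<Sum>j=1..M. \<theta> j) = 1" using assms by (simp add: weight_simplex_def)
  have "(\<Sum>j=1..M. \<theta> j * (w j - d)\<^sup>2) = (\<Sum>j=1..M. \<theta> j * (w j)\<^sup>2) - 2 * d * ?m + d\<^sup>2" for d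
  proof -
    have "(\<Sum>j=1..M. \<theta> j * (w j - d)\<^sup>2)
      = (\<Sum>j=1..M. \<theta> j * (w j)\<^sup>2 - 2 * d * (\<theta> j * w j) + \<theta> j * d\<^sup>2)"
      by (intro sum.cong) (auto simp: power2_eq_square algebra_simps)
    thus ?thesis using s by (simp add: sum.distrib sum_subtractf flip: sum_distrib_left sum_distrib_right)
  qed
  from this[of c] this[of ?m] show ?thesis by (simp add: power2_eq_square algebra_simps)
qed

lemma strongly_convex_on_mod_convex_on:
  assumes "strongly_convex_on_mod {a..c} C h"
  shows "convex_on {a..c} (\<lambda>u. h u - C / 2 * u\<^sup>2)"
proof (rule convex_onI)
  fix t x y :: real assume t: "0 < t" "t < 1" and xy: "x \<in> {a..c}" "y \<in> {a..c}"
  have "h ((1 - t) * x + t * y) \<le> (1 - t) * h x + t * h y - C / 2 * (1 - t) * t * (x - y)\<^sup>2"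
    using assms t xy unfolding strongly_convex_on_mod_def
    by (elim ballE[of _ _ x] ballE[of _ _ y] allE[of _ "1 - t"]) auto
  moreover have "C / 2 * ((1 - t) * x + t * y)\<^sup>2
     = (1 - t) * (C / 2 * x\<^sup>2) + t * (C / 2 * y\<^sup>2) - C / 2 * (1 - t) * t * (x - y)\<^sup>2"
    by (simp add: power2_eq_square field_simps)
  ultimately show "h ((1 - t) *\<^sub>R x + t *\<^sub>R y) - C / 2 * ((1 - t) *\<^sub>R x + t *\<^sub>R y)\<^sup>2
     \<le> (1 - t) * (h x - C / 2 * x\<^sup>2) + t * (h y - C / 2 * y\<^sup>2)"
    unfolding real_scaleR_def right_diff_distrib by linarith
qed simp

text \<open>Jensen's inequality for the convex function \<open>h u - C / 2 * u\<^sup>2\<close>. The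
  Jensen gap of the square is exactly a variance, which is the gain on the left.\<close>

lemma strongly_convex_on_mod_mean:
  fixes w :: "nat \<Rightarrow> real"
  assumes "strongly_convex_on_mod {a..c} C h" and \<theta>: "\<theta> \<in> weight_simplex M"
    and w: "\<And>j. j \<in> {1..M} \<Longrightarrow> w j \<in> {a..c}"
  shows "h (\<Sum>j=1..M. \<theta> j * w j) + C / 2 * (\<Sum>j=1..M. \<theta> j * (w j - (\<Sum>j=1..M. \<theta> j * w j))\<^sup>2)
     \<le> (\<Sum>j=1..M. \<theta> j * h (w j))"
proof -
  let ?m = "\<Sum>j=1..M. \<theta> j * w j"
  have ne: "{1..M} \<noteq> {}" using \<theta> by (auto simp: weight_simplex_def simp del: atLeastatMost_empty_iff)
  have "h (\<Sum>j=1..M. \<theta> j *\<^sub>R w j) - C / 2 * (\<Sum>j=1..M. \<theta> j *\<^sub>R w j)\<^sup>2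
      \<le> (\<Sum>j=1..M. \<theta> j * (h (w j) - C / 2 * (w j)\<^sup>2))"
    using \<theta> w ne
    by (intro convex_on_sum[OF _ _ strongly_convex_on_mod_convex_on[OF assms(1)]])
       (auto simp: weight_simplex_def)
  also have "\<dots> = (\<Sum>j=1..M. \<theta> j * h (w j)) - C / 2 * (\<Sum>j=1..M. \<theta> j * (w j - 0)\<^sup>2)"
    by (simp add: algebra_simps sum_subtractf sum_distrib_left sum_divide_distrib)
  also have "(\<Sum>j=1..M. \<theta> j * (w j - 0)\<^sup>2) = (\<Sum>j=1..M. \<theta> j * (w j - ?m)\<^sup>2) + (?m - 0)\<^sup>2"
    by (rule weight_simplex_mean_square[OF \<theta>])
  finally show ?thesis by (simp add: algebra_simps)
qed

text \<open>Weights are functions on all naturals, so \<open>weight_simplex M\<close> leaves the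
  coordinates outside \<open>{1..M}\<close> free and is not compact. The minimum is taken on the
  slice where they are zero.\<close>

lemma weight_simplex_attains_min:
  fixes H :: "(nat \<Rightarrow> real) \<Rightarrow> real"
  assumes M: "0 < M"
    and lip: "\<And>\<theta> \<eta>. \<theta> \<in> weight_simplex M \<Longrightarrow> \<eta> \<in> weight_simplex M
               \<Longrightarrow> \<bar>H \<theta> - H \<eta>\<bar> \<le> K * (\<Sum>j=1..M. \<bar>\<theta> j - \<eta> j\<bar>)"
  obtains \<eta> where "\<eta> \<in> weight_simplex M" "\<And>\<theta>. \<theta> \<in> weight_simplex M \<Longrightarrow> H \<eta> \<le> H \<theta>"
proof -
  define B where "B = (\<Pi>\<^sub>E j\<in>UNIV. if j \<in> {1..M} then {0..1::real} else {0})"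
  have "compactin (product_topology (\<lambda>_::nat. euclidean) UNIV) B"
    unfolding B_def compactin_PiE by auto
  hence "compact B" by (simp add: euclidean_product_topology)
  moreover have "closed {\<theta> :: nat \<Rightarrow> real. (\<Sum>j=1..M. \<theta> j) = 1}"
    by (intro closed_Collect_eq continuous_intros continuous_on_product_coordinates)
  ultimately have S: "compact (B \<inter> {\<theta>. (\<Sum>j=1..M. \<theta> j) = 1})" (is "compact ?S")
    by (rule compact_Int_closed)
  have sub: "?S \<subseteq> weight_simplex M"
    by (auto simp: B_def weight_simplex_def PiE_def Pi_def split: if_splits)
  have cont: "continuous_on ?S H"
    unfolding continuous_on_def
  proof
    fix \<eta> assume \<eta>: "\<eta> \<in> ?S"
    have "((\<lambda>\<theta>. K * (\<Sum>j=1..M. \<bar>\<theta> j - \<eta> j\<bar>)) \<longlongrightarrow> K * (\<Sum>j=1..M. \<bar>\<eta> j - \<eta> j\<bar>)) (at \<eta> within ?S)"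
    proof -
      have "continuous_on ?S (\<lambda>\<theta>. K * (\<Sum>j=1..M. \<bar>\<theta> j - \<eta> j\<bar>))"
        by (intro continuous_intros continuous_on_subset[OF continuous_on_product_coordinates] subset_UNIV)
      thus ?thesis using \<eta> unfolding continuous_on_def by fast
    qed
    hence "((\<lambda>\<theta>. K * (\<Sum>j=1..M. \<bar>\<theta> j - \<eta> j\<bar>)) \<longlongrightarrow> 0) (at \<eta> within ?S)" by simp
    moreover have "eventually (\<lambda>\<theta>. norm (H \<theta> - H \<eta>) \<le> K * (\<Sum>j=1..M. \<bar>\<theta> j - \<eta> j\<bar>)) (at \<eta> within ?S)"
      using lip sub \<eta> by (auto simp: eventually_at_topological intro!: exI[of _ UNIV])
    ultimately have "((\<lambda>\<theta>. H \<theta> - H \<eta>) \<longlongrightarrow> 0) (at \<eta> within ?S)"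
      by (rule Lim_null_comparison[rotated])
    thus "(H \<longlongrightarrow> H \<eta>) (at \<eta> within ?S)" by (simp add: LIM_zero_iff)
  qed
  \<comment> \<open>The Lipschitz bound only sees coordinates in \<open>{1..M}\<close>, so zeroing
    the others leaves \<open>H\<close> unchanged.\<close>
  have to_S: "\<exists>\<theta>'\<in>?S. H \<theta>' = H \<theta>" if \<theta>: "\<theta> \<in> weight_simplex M" for \<theta>
  proof -
    let ?t = "\<lambda>j. if j \<in> {1..M} then \<theta> j else 0"
    have "\<theta> j \<le> 1" if "j \<in> {1..M}" for j
      using member_le_sum[of j "{1..M}" \<theta>] \<theta> that by (auto simp: weight_simplex_def)
    hence t: "?t \<in> ?S" using \<theta> by (auto simp: B_def weight_simplex_def PiE_def)
    moreover have "\<bar>H ?t - H \<theta>\<bar> \<le> K * (\<Sum>j=1..M. \<bar>?t j - \<theta> j\<bar>)"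
      using t \<theta> sub by (intro lip) auto
    ultimately show ?thesis by (intro bexI[of _ ?t]) simp_all
  qed
  have "?S \<noteq> {}" using to_S[OF weight_simplex_vertex[of 1]] M by fastforce
  with continuous_attains_inf[OF S _ cont] obtain \<eta> where \<eta>: "\<eta> \<in> ?S" "\<And>\<theta>. \<theta> \<in> ?S \<Longrightarrow> H \<eta> \<le> H \<theta>"
    by blast
  show ?thesis
  proof
    show "\<eta> \<in> weight_simplex M" using \<eta> sub by blast
    show "H \<eta> \<le> H \<theta>" if "\<theta> \<in> weight_simplex M" for \<theta>
      using to_S[OF that] \<eta>(2) by metis
  qed
qed

text \<open>An observation is a single point \<open>z\<close>, and \<open>G z u\<close> is the loss
  of the prediction \<open>u\<close> at \<open>z\<close>. Joint measurability of \<open>G\<close>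
  makes the risk of random weights measurable.\<close>

locale dictionary = prob_space P
  for P :: "'z measure" +
  fixes F :: "nat \<Rightarrow> 'z \<Rightarrow> real" and G :: "'z \<Rightarrow> real \<Rightarrow> real" and M :: nat and b L C :: real
  assumes M_pos: "0 < M" and b_pos: "0 < b" and C_pos: "0 < C"
    and F_meas[measurable]: "\<And>j. j \<in> {1..M} \<Longrightarrow> F j \<in> borel_measurable P"
    and G_meas: "(\<lambda>(z, u). G z u) \<in> borel_measurable (P \<Otimes>\<^sub>M borel)"
    and F_bounded: "AE z in P. \<forall>j\<in>{1..M}. \<bar>F j z\<bar> \<le> b"
    and G_Lipschitz: "AE z in P. \<forall>u\<in>{-b..b}. \<forall>v\<in>{-b..b}. \<bar>G z u - G z v\<bar> \<le> L * \<bar>u - v\<bar>"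
    and G_strongly_convex: "AE z in P. strongly_convex_on_mod {-b..b} C (G z)"
    and G_F_integrable: "\<And>j. j \<in> {1..M} \<Longrightarrow> integrable P (\<lambda>z. G z (F j z))"
begin

abbreviation "\<Theta> \<equiv> weight_simplex M"
abbreviation "agg \<equiv> f_agg F M"

text \<open>A single exceptional null set serves all weight vectors at once, although there are
  uncountably many.\<close>

definition good :: "'z \<Rightarrow> bool" where
  "good z \<longleftrightarrow> (\<forall>j\<in>{1..M}. \<bar>F j z\<bar> \<le> b) \<and>
     (\<forall>u\<in>{-b..b}. \<forall>v\<in>{-b..b}. \<bar>G z u - G z v\<bar> \<le> L * \<bar>u - v\<bar>) \<and>
     strongly_convex_on_mod {-b..b} C (G z)"

definition agg_risk :: "(nat \<Rightarrow> real) \<Rightarrow> real" where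
  "agg_risk \<theta> = (\<integral>z. G z (agg \<theta> z) \<partial>P)"

definition dict_risk :: "nat \<Rightarrow> real" where
  "dict_risk j = (\<integral>z. G z (F j z) \<partial>P)"

definition dict_dist :: "(nat \<Rightarrow> real) \<Rightarrow> nat \<Rightarrow> real" where
  "dict_dist \<eta> j = (\<integral>z. (F j z - agg \<eta> z)\<^sup>2 \<partial>P)"

definition agg_dist :: "(nat \<Rightarrow> real) \<Rightarrow> (nat \<Rightarrow> real) \<Rightarrow> real" where
  "agg_dist \<theta> \<eta> = (\<integral>z. (agg \<theta> z - agg \<eta> z)\<^sup>2 \<partial>P)"

text \<open>The variance of \<open>F j z\<close> for an index \<open>j\<close> drawn from
  \<open>\<theta>\<close>, averaged over \<open>z\<close>.\<close>

definition agg_var :: "(nat \<Rightarrow> real) \<Rightarrow> real" where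
  "agg_var \<theta> = (\<Sum>j=1..M. \<theta> j * dict_dist \<theta> j)"

lemma AE_good: "AE z in P. good z"
  using F_bounded G_Lipschitz G_strongly_convex by eventually_elim (simp add: good_def)

lemma good_bounded: "good z \<Longrightarrow> j \<in> {1..M} \<Longrightarrow> \<bar>F j z\<bar> \<le> b"
  by (simp add: good_def)

lemma good_Lipschitz: "good z \<Longrightarrow> \<bar>u\<bar> \<le> b \<Longrightarrow> \<bar>v\<bar> \<le> b \<Longrightarrow> \<bar>G z u - G z v\<bar> \<le> L * \<bar>u - v\<bar>"
  by (simp add: good_def abs_le_iff)

lemma agg_bounded: "good z \<Longrightarrow> \<theta> \<in> \<Theta> \<Longrightarrow> \<bar>agg \<theta> z\<bar> \<le> b"
  unfolding f_agg_def by (intro weight_simplex_mean_bound good_bounded)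

text \<open>Strong convexity at \<open>-b\<close>, \<open>0\<close>, \<open>b\<close> forces the
  values at the two ends to exceed twice the middle one by at least \<open>C * b\<^sup>2\<close>,
  while the Lipschitz bound allows at most \<open>2 * L * b\<close>. This relation later converts a
  bound on \<open>\<beta>\<close> in terms of \<open>L\<^sup>2\<close> into one in terms of
  \<open>L * b\<close>.\<close>

lemma L_lower: "C * b / 2 \<le> L"
proof -
  obtain z where z: "good z"
  proof -
    have "\<exists>z. good z"
    proof (rule ccontr)
      assume "\<nexists>z. good z"
      with AE_good have "AE z in P. False" by simp
      thus False by simp
    qed
    thus thesis using that by blast
  qed
  have "G z ((1/2) * b + (1 - 1/2) * (-b)) \<le> 1/2 * G z b + (1 - 1/2) * G z (-b)
         - C / 2 * (1/2) * (1 - 1/2) * (b - (-b))\<^sup>2"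
    using z b_pos unfolding good_def strongly_convex_on_mod_def
    by (elim conjE) (erule ballE[of _ _ b], erule ballE[of _ _ "-b"], erule allE[of _ "1/2"], simp_all)
  hence "C * b\<^sup>2 \<le> (G z b - G z 0) + (G z (-b) - G z 0)"
    by (simp add: field_simps power2_eq_square)
  also have "\<dots> \<le> L * b + L * b"
    using good_Lipschitz[OF z, of b 0] good_Lipschitz[OF z, of "-b" 0] b_pos by simp
  finally show ?thesis using b_pos by (simp add: power2_eq_square field_simps)
qed

lemma L_pos: "0 < L"
  using L_lower C_pos b_pos by (smt (verit) divide_pos_pos mult_pos_pos)

lemma agg_measurable[measurable]: "agg \<theta> \<in> borel_measurable P"
  unfolding f_agg_def by measurable

lemma G_measurable:
  assumes "u \<in> borel_measurable P"
  shows "(\<lambda>z. G z (u z)) \<in> borel_measurable P"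
  using measurable_compose[OF measurable_Pair[OF measurable_ident_sets[OF refl] assms] G_meas] by simp

lemma integrable_AE_bounded:
  fixes u :: "'z \<Rightarrow> real"
  assumes "u \<in> borel_measurable P" "AE z in P. \<bar>u z\<bar> \<le> B"
  shows "integrable P u"
  using assms by (intro integrable_const_bound[of _ B]) auto

lemma integrable_dict_sq: "\<eta> \<in> \<Theta> \<Longrightarrow> j \<in> {1..M} \<Longrightarrow> integrable P (\<lambda>z. (F j z - agg \<eta> z)\<^sup>2)"
proof (rule integrable_AE_bounded)
  assume mem: "\<eta> \<in> \<Theta>" "j \<in> {1..M}"
  from AE_good show "AE z in P. \<bar>(F j z - agg \<eta> z)\<^sup>2\<bar> \<le> (2 * b)\<^sup>2"
  proof eventually_elim
    case (elim z)
    with mem good_bounded[of z j] agg_bounded[of z \<eta>] have "\<bar>F j z - agg \<eta> z\<bar> \<le> \<bar>2 * b\<bar>" by auto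
    thus ?case by (simp add: abs_le_square_iff)
  qed
qed simp

lemma integrable_mean_dict_sq: "\<theta> \<in> \<Theta> \<Longrightarrow> \<eta> \<in> \<Theta> \<Longrightarrow> integrable P (\<lambda>z. \<Sum>j=1..M. \<theta> j * (F j z - agg \<eta> z)\<^sup>2)"
  by (intro Bochner_Integration.integrable_sum integrable_mult_right integrable_dict_sq)

lemma expectation_mean_dict_sq:
  "\<theta> \<in> \<Theta> \<Longrightarrow> \<eta> \<in> \<Theta>
    \<Longrightarrow> expectation (\<lambda>z. \<Sum>j=1..M. \<theta> j * (F j z - agg \<eta> z)\<^sup>2) = (\<Sum>j=1..M. \<theta> j * dict_dist \<eta> j)"
  unfolding dict_dist_def
  by (subst Bochner_Integration.integral_sum) (auto intro!: integrable_mult_right integrable_dict_sq)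

lemma integrable_agg_sq: "\<theta> \<in> \<Theta> \<Longrightarrow> \<eta> \<in> \<Theta> \<Longrightarrow> integrable P (\<lambda>z. (agg \<theta> z - agg \<eta> z)\<^sup>2)"
proof (rule integrable_AE_bounded)
  assume mem: "\<theta> \<in> \<Theta>" "\<eta> \<in> \<Theta>"
  from AE_good show "AE z in P. \<bar>(agg \<theta> z - agg \<eta> z)\<^sup>2\<bar> \<le> (2 * b)\<^sup>2"
  proof eventually_elim
    case (elim z)
    with mem agg_bounded[of z \<theta>] agg_bounded[of z \<eta>] have "\<bar>agg \<theta> z - agg \<eta> z\<bar> \<le> \<bar>2 * b\<bar>" by auto
    thus ?case by (simp add: abs_le_square_iff)
  qed
qed simp

text \<open>The loss itself may be unbounded; only differences of losses are controlled.
  Integrability is therefore inherited from the dictionary element \<open>F 1\<close>.\<close>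

lemma integrable_agg_risk:
  assumes \<theta>: "\<theta> \<in> \<Theta>"
  shows "integrable P (\<lambda>z. G z (agg \<theta> z))"
proof -
  have 1: "1 \<in> {1..M}" using M_pos by auto
  have "integrable P (\<lambda>z. G z (agg \<theta> z) - G z (F 1 z))"
  proof (rule integrable_AE_bounded)
    show "AE z in P. \<bar>G z (agg \<theta> z) - G z (F 1 z)\<bar> \<le> L * (2 * b)"
      using AE_good
    proof eventually_elim
      case (elim z)
      have "\<bar>G z (agg \<theta> z) - G z (F 1 z)\<bar> \<le> L * \<bar>agg \<theta> z - F 1 z\<bar>"
        using elim \<theta> 1 by (intro good_Lipschitz agg_bounded good_bounded)
      also have "\<dots> \<le> L * (2 * b)"
        using agg_bounded[OF elim \<theta>] good_bounded[OF elim 1] L_pos by (intro mult_left_mono) auto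
      finally show ?case .
    qed
    show "(\<lambda>z. G z (agg \<theta> z) - G z (F 1 z)) \<in> borel_measurable P"
      using 1 by (intro borel_measurable_diff G_measurable) auto
  qed
  from Bochner_Integration.integrable_add[OF this G_F_integrable[OF 1]] show ?thesis by simp
qed

lemma dict_dist_nonneg: "0 \<le> dict_dist \<eta> j"
  by (simp add: dict_dist_def)

lemma agg_var_nonneg: "\<theta> \<in> \<Theta> \<Longrightarrow> 0 \<le> agg_var \<theta>"
  by (auto simp: agg_var_def weight_simplex_def intro!: sum_nonneg mult_nonneg_nonneg dict_dist_nonneg)

lemma agg_var_vertex: "j \<in> {1..M} \<Longrightarrow> agg_var (indicator {j}) = 0"
  by (simp add: agg_var_def sum_vertex dict_dist_def f_agg_vertex)

lemma agg_risk_vertex: "j \<in> {1..M} \<Longrightarrow> agg_risk (indicator {j}) = dict_risk j"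
  by (simp add: agg_risk_def dict_risk_def f_agg_vertex)

lemma mean_dict_dist:
  assumes "\<theta> \<in> \<Theta>" "\<eta> \<in> \<Theta>"
  shows "(\<Sum>j=1..M. \<theta> j * dict_dist \<eta> j) = agg_var \<theta> + agg_dist \<theta> \<eta>"
proof -
  have "(\<Sum>j=1..M. \<theta> j * dict_dist \<eta> j) = (\<integral>z. (\<Sum>j=1..M. \<theta> j * (F j z - agg \<eta> z)\<^sup>2) \<partial>P)"
    using assms by (simp only: expectation_mean_dict_sq)
  also have "\<dots> = (\<integral>z. (\<Sum>j=1..M. \<theta> j * (F j z - agg \<theta> z)\<^sup>2) + (agg \<theta> z - agg \<eta> z)\<^sup>2 \<partial>P)"
    unfolding f_agg_def by (intro Bochner_Integration.integral_cong refl weight_simplex_mean_square assms)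
  also have "\<dots> = agg_var \<theta> + agg_dist \<theta> \<eta>"
    using assms unfolding agg_var_def agg_dist_def
    by (subst Bochner_Integration.integral_add)
       (simp_all only: integrable_mean_dict_sq integrable_agg_sq expectation_mean_dict_sq)
  finally show ?thesis .
qed

text \<open>For a fixed reference \<open>\<eta>\<close> the mean of \<open>dict_dist \<eta>\<close>
  is linear in the weights, so \<open>mean_dict_dist\<close> leaves \<open>agg_dist\<close> as the
  only quadratic term. The identity measures exactly the concavity that the minimisation defining
  the reference weights must tolerate.\<close>

lemma agg_var_combine:
  assumes "\<theta> \<in> \<Theta>" "\<eta> \<in> \<Theta>" "0 \<le> a" "a \<le> 1"
  shows "agg_var (\<lambda>j. a * \<theta> j + (1 - a) * \<eta> j)
       = a * agg_var \<theta> + (1 - a) * agg_var \<eta> + a * (1 - a) * agg_dist \<theta> \<eta>"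
proof -
  let ?c = "\<lambda>j. a * \<theta> j + (1 - a) * \<eta> j"
  have c: "?c \<in> \<Theta>" by (rule weight_simplex_combine) fact+
  have "agg_var ?c + agg_dist ?c \<eta> = a * (\<Sum>j=1..M. \<theta> j * dict_dist \<eta> j) + (1 - a) * agg_var \<eta>"
    unfolding mean_dict_dist[OF c assms(2), symmetric]
    unfolding agg_var_def sum_distrib_left sum.distrib[symmetric]
    by (intro sum.cong refl) (simp add: algebra_simps)
  also have "\<dots> = a * agg_var \<theta> + a * agg_dist \<theta> \<eta> + (1 - a) * agg_var \<eta>"
    using mean_dict_dist[OF assms(1,2)] by (simp add: algebra_simps)
  finally have "agg_var ?c + agg_dist ?c \<eta> = a * agg_var \<theta> + a * agg_dist \<theta> \<eta> + (1 - a) * agg_var \<eta>" .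
  moreover have "agg_dist ?c \<eta> = a\<^sup>2 * agg_dist \<theta> \<eta>"
  proof -
    have "agg ?c z - agg \<eta> z = a * (agg \<theta> z - agg \<eta> z)" for z
      unfolding f_agg_combine by (simp add: algebra_simps)
    thus ?thesis by (simp add: agg_dist_def power_mult_distrib)
  qed
  ultimately show ?thesis by (simp add: power2_eq_square algebra_simps)
qed

lemma agg_risk_combine:
  assumes "\<theta> \<in> \<Theta>" "\<eta> \<in> \<Theta>" "0 < a" "a < 1"
  shows "agg_risk (\<lambda>j. a * \<theta> j + (1 - a) * \<eta> j)
       \<le> a * agg_risk \<theta> + (1 - a) * agg_risk \<eta> - C / 2 * a * (1 - a) * agg_dist \<theta> \<eta>"
proof -
  let ?c = "\<lambda>j. a * \<theta> j + (1 - a) * \<eta> j"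
  have c: "?c \<in> \<Theta>" using assms by (intro weight_simplex_combine) auto
  have "agg_risk ?c \<le> (\<integral>z. a * G z (agg \<theta> z) + (1 - a) * G z (agg \<eta> z)
         - C / 2 * a * (1 - a) * (agg \<theta> z - agg \<eta> z)\<^sup>2 \<partial>P)"
    unfolding agg_risk_def
  proof (rule integral_mono_AE)
    show "AE z in P. G z (agg ?c z) \<le> a * G z (agg \<theta> z) + (1 - a) * G z (agg \<eta> z)
         - C / 2 * a * (1 - a) * (agg \<theta> z - agg \<eta> z)\<^sup>2"
      using AE_good
    proof eventually_elim
      case (elim z)
      with assms agg_bounded[OF elim, of \<theta>] agg_bounded[OF elim, of \<eta>] show ?case
        unfolding f_agg_combine good_def strongly_convex_on_mod_def by (auto simp: abs_le_iff)
    qed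
  qed (use assms c in \<open>auto intro!: integrable_agg_risk integrable_agg_sq
       Bochner_Integration.integrable_add Bochner_Integration.integrable_diff integrable_mult_right
       simp del: times_divide_eq_left\<close>)
  also have "\<dots> = a * agg_risk \<theta> + (1 - a) * agg_risk \<eta> - C / 2 * a * (1 - a) * agg_dist \<theta> \<eta>"
    using assms by (simp add: agg_risk_def agg_dist_def integrable_agg_risk integrable_agg_sq)
  finally show ?thesis .
qed

text \<open>The variance gain is what the linear term of the \<open>Q\<close> objective brings: it
  pays for \<open>agg_var\<close> at the selected weights.\<close>

lemma agg_risk_le_mean_dict_risk:
  assumes \<theta>: "\<theta> \<in> \<Theta>"
  shows "agg_risk \<theta> + C / 2 * agg_var \<theta> \<le> (\<Sum>j=1..M. \<theta> j * dict_risk j)"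
proof -
  have "agg_risk \<theta> + C / 2 * agg_var \<theta>
      = (\<integral>z. G z (agg \<theta> z) + C / 2 * (\<Sum>j=1..M. \<theta> j * (F j z - agg \<theta> z)\<^sup>2) \<partial>P)"
    using \<theta> unfolding agg_risk_def agg_var_def
    by (subst Bochner_Integration.integral_add)
       (simp_all only: integrable_mean_dict_sq integrable_agg_risk expectation_mean_dict_sq
          integrable_mult_right integral_mult_right_zero)
  also have "\<dots> \<le> (\<integral>z. (\<Sum>j=1..M. \<theta> j * G z (F j z)) \<partial>P)"
  proof (rule integral_mono_AE)
    show "AE z in P. G z (agg \<theta> z) + C / 2 * (\<Sum>j=1..M. \<theta> j * (F j z - agg \<theta> z)\<^sup>2)
       \<le> (\<Sum>j=1..M. \<theta> j * G z (F j z))"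
      using AE_good
    proof eventually_elim
      case (elim z)
      thus ?case unfolding f_agg_def
        using good_bounded[OF \<open>good z\<close>]
        by (intro strongly_convex_on_mod_mean[OF _ \<theta>]) (auto simp: good_def abs_le_iff minus_le_iff)
    qed
    show "integrable P (\<lambda>z. G z (agg \<theta> z) + C / 2 * (\<Sum>j=1..M. \<theta> j * (F j z - agg \<theta> z)\<^sup>2))"
      by (intro Bochner_Integration.integrable_add integrable_agg_risk integrable_mult_right
            integrable_mean_dict_sq \<theta>)
    show "integrable P (\<lambda>z. \<Sum>j=1..M. \<theta> j * G z (F j z))"
      by (intro Bochner_Integration.integrable_sum integrable_mult_right G_F_integrable)
  qed
  also have "\<dots> = (\<Sum>j=1..M. \<theta> j * dict_risk j)"
    by (simp add: dict_risk_def G_F_integrable)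
  finally show ?thesis .
qed

lemma agg_diff_le:
  assumes "good z"
  shows "\<bar>agg \<theta> z - agg \<eta> z\<bar> \<le> b * (\<Sum>j=1..M. \<bar>\<theta> j - \<eta> j\<bar>)"
proof -
  have "agg \<theta> z - agg \<eta> z = (\<Sum>j=1..M. (\<theta> j - \<eta> j) * F j z)"
    by (simp add: f_agg_def algebra_simps sum_subtractf)
  also have "\<bar>\<dots>\<bar> \<le> (\<Sum>j=1..M. b * \<bar>\<theta> j - \<eta> j\<bar>)"
    using good_bounded[OF assms]
    by (intro order_trans[OF sum_abs] sum_mono) (auto simp: abs_mult mult.commute intro!: mult_right_mono)
  finally show ?thesis by (simp add: sum_distrib_left)
qed

lemma agg_risk_Lipschitz:
  assumes "\<theta> \<in> \<Theta>" "\<eta> \<in> \<Theta>"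
  shows "\<bar>agg_risk \<theta> - agg_risk \<eta>\<bar> \<le> L * b * (\<Sum>j=1..M. \<bar>\<theta> j - \<eta> j\<bar>)"
proof -
  have "\<bar>agg_risk \<theta> - agg_risk \<eta>\<bar> = \<bar>\<integral>z. G z (agg \<theta> z) - G z (agg \<eta> z) \<partial>P\<bar>"
    using assms by (simp add: agg_risk_def integrable_agg_risk)
  also have "\<dots> \<le> (\<integral>z. \<bar>G z (agg \<theta> z) - G z (agg \<eta> z)\<bar> \<partial>P)" by (rule integral_abs_bound)
  also have "\<dots> \<le> (\<integral>z. L * b * (\<Sum>j=1..M. \<bar>\<theta> j - \<eta> j\<bar>) \<partial>P)"
  proof (rule integral_mono_AE)
    show "AE z in P. \<bar>G z (agg \<theta> z) - G z (agg \<eta> z)\<bar> \<le> L * b * (\<Sum>j=1..M. \<bar>\<theta> j - \<eta> j\<bar>)"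
      using AE_good
    proof eventually_elim
      case (elim z)
      have "\<bar>G z (agg \<theta> z) - G z (agg \<eta> z)\<bar> \<le> L * \<bar>agg \<theta> z - agg \<eta> z\<bar>"
        by (intro good_Lipschitz elim agg_bounded assms)
      also have "\<dots> \<le> L * (b * (\<Sum>j=1..M. \<bar>\<theta> j - \<eta> j\<bar>))"
        using L_pos agg_diff_le[OF elim] by (intro mult_left_mono) auto
      finally show ?case by (simp add: mult_ac)
    qed
  qed (use assms in \<open>auto intro!: integrable_agg_risk\<close>)
  finally show ?thesis by (simp add: prob_space)
qed

lemma agg_sq_Lipschitz:
  assumes "\<theta> \<in> \<Theta>" "\<eta> \<in> \<Theta>" "\<zeta> \<in> \<Theta>"
  shows "\<bar>agg_dist \<theta> \<zeta> - agg_dist \<eta> \<zeta>\<bar> \<le> 4 * b\<^sup>2 * (\<Sum>j=1..M. \<bar>\<theta> j - \<eta> j\<bar>)"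
proof -
  have "\<bar>agg_dist \<theta> \<zeta> - agg_dist \<eta> \<zeta>\<bar> = \<bar>\<integral>z. (agg \<theta> z - agg \<zeta> z)\<^sup>2 - (agg \<eta> z - agg \<zeta> z)\<^sup>2 \<partial>P\<bar>"
    using assms by (simp add: agg_dist_def integrable_agg_sq)
  also have "\<dots> \<le> (\<integral>z. \<bar>(agg \<theta> z - agg \<zeta> z)\<^sup>2 - (agg \<eta> z - agg \<zeta> z)\<^sup>2\<bar> \<partial>P)" by (rule integral_abs_bound)
  also have "\<dots> \<le> (\<integral>z. 4 * b\<^sup>2 * (\<Sum>j=1..M. \<bar>\<theta> j - \<eta> j\<bar>) \<partial>P)"
  proof (rule integral_mono_AE)
    show "AE z in P. \<bar>(agg \<theta> z - agg \<zeta> z)\<^sup>2 - (agg \<eta> z - agg \<zeta> z)\<^sup>2\<bar> \<le> 4 * b\<^sup>2 * (\<Sum>j=1..M. \<bar>\<theta> j - \<eta> j\<bar>)"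
      using AE_good
    proof eventually_elim
      case (elim z)
      have "(agg \<theta> z - agg \<zeta> z)\<^sup>2 - (agg \<eta> z - agg \<zeta> z)\<^sup>2
         = (agg \<theta> z + agg \<eta> z - 2 * agg \<zeta> z) * (agg \<theta> z - agg \<eta> z)"
        by (simp add: power2_eq_square algebra_simps)
      also have "\<bar>\<dots>\<bar> \<le> (4 * b) * (b * (\<Sum>j=1..M. \<bar>\<theta> j - \<eta> j\<bar>))"
        unfolding abs_mult using agg_bounded[OF elim assms(1)] agg_bounded[OF elim assms(2)]
          agg_bounded[OF elim assms(3)] b_pos
        by (intro mult_mono agg_diff_le elim) auto
      finally show ?case by (simp add: power2_eq_square mult_ac)
    qed
  qed (use assms in \<open>auto intro!: integrable_agg_sq\<close>)
  finally show ?thesis by (simp add: prob_space)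
qed

section \<open>Deterministic reference weights and quadratic growth\<close>

definition pen_risk :: "real \<Rightarrow> (nat \<Rightarrow> real) \<Rightarrow> (nat \<Rightarrow> real) \<Rightarrow> real" where
  "pen_risk \<nu> \<kappa> \<theta> = (1 - \<nu>) * agg_risk \<theta> + (\<Sum>j=1..M. \<theta> j * (\<nu> * dict_risk j + \<kappa> j))"

text \<open>\<open>\<eta>\<close> minimises
  \<open>pen_risk \<nu> \<kappa> \<theta> + \<mu> * agg_var \<theta>\<close>. Comparison with
  vertices, where \<open>agg_var\<close> is zero, gives the second property; comparison with
  mixtures of \<open>\<theta>\<close> and \<open>\<eta>\<close> gives the third.\<close>

lemma ex_reference_weights:
  assumes \<nu>: "0 < \<nu>" "\<nu> < 1" and \<mu>: "0 < \<mu>" "10 * \<mu> \<le> (1 - \<nu>) * C"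
  obtains \<eta> where "\<eta> \<in> \<Theta>"
    "\<And>j. j \<in> {1..M} \<Longrightarrow> pen_risk \<nu> \<kappa> \<eta> + \<mu> * agg_var \<eta> \<le> dict_risk j + \<kappa> j"
    "\<And>\<theta>. \<theta> \<in> \<Theta> \<Longrightarrow> pen_risk \<nu> \<kappa> \<eta> + \<mu> * agg_var \<eta> + 4 * \<mu> * agg_dist \<theta> \<eta> \<le> pen_risk \<nu> \<kappa> \<theta> + \<mu> * agg_var \<theta>"
proof -
  define H where "H \<theta> = pen_risk \<nu> \<kappa> \<theta> + \<mu> * agg_var \<theta>" for \<theta>
  \<comment> \<open>An auxiliary fixed weight vector: relative to it \<open>mean_dict_dist\<close>
    writes \<open>agg_var\<close> as a linear function minus \<open>agg_dist\<close>, and both are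
    visibly Lipschitz.\<close>
  define \<zeta> :: "nat \<Rightarrow> real" where "\<zeta> = indicator {1}"
  have \<zeta>: "\<zeta> \<in> \<Theta>" unfolding \<zeta>_def using M_pos by (intro weight_simplex_vertex) auto
  define w where "w j = \<nu> * dict_risk j + \<kappa> j + \<mu> * dict_dist \<zeta> j" for j
  define W where "W = (\<Sum>j=1..M. \<bar>w j\<bar>)"
  have H: "H \<theta> = (1 - \<nu>) * agg_risk \<theta> - \<mu> * agg_dist \<theta> \<zeta> + (\<Sum>j=1..M. \<theta> j * w j)" if "\<theta> \<in> \<Theta>" for \<theta>
  proof -
    have "(\<Sum>j=1..M. \<theta> j * w j)
       = (\<Sum>j=1..M. \<theta> j * (\<nu> * dict_risk j + \<kappa> j)) + \<mu> * (\<Sum>j=1..M. \<theta> j * dict_dist \<zeta> j)"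
      unfolding w_def sum_distrib_left sum.distrib[symmetric]
      by (intro sum.cong refl) (simp add: algebra_simps)
    thus ?thesis unfolding mean_dict_dist[OF that \<zeta>] H_def pen_risk_def by (simp add: algebra_simps)
  qed
  have Hlip: "\<bar>H \<theta> - H \<eta>\<bar> \<le> (L * b + \<mu> * (4 * b\<^sup>2) + W) * (\<Sum>j=1..M. \<bar>\<theta> j - \<eta> j\<bar>)"
    if "\<theta> \<in> \<Theta>" "\<eta> \<in> \<Theta>" for \<theta> \<eta>
  proof -
    let ?S = "\<Sum>j=1..M. \<bar>\<theta> j - \<eta> j\<bar>"
    have "\<bar>(\<Sum>j=1..M. \<theta> j * w j) - (\<Sum>j=1..M. \<eta> j * w j)\<bar> = \<bar>\<Sum>j=1..M. (\<theta> j - \<eta> j) * w j\<bar>"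
      by (simp add: algebra_simps sum_subtractf)
    also have "\<dots> \<le> (\<Sum>j=1..M. \<bar>\<theta> j - \<eta> j\<bar> * W)"
      unfolding W_def by (intro order_trans[OF sum_abs] sum_mono)
        (auto simp: abs_mult intro!: mult_left_mono member_le_sum)
    finally have 1: "\<bar>(\<Sum>j=1..M. \<theta> j * w j) - (\<Sum>j=1..M. \<eta> j * w j)\<bar> \<le> W * ?S"
      by (simp add: sum_distrib_left mult.commute)
    have 2: "\<bar>\<mu> * (agg_dist \<theta> \<zeta> - agg_dist \<eta> \<zeta>)\<bar> \<le> \<mu> * (4 * b\<^sup>2 * ?S)"
      unfolding abs_mult using \<mu> agg_sq_Lipschitz[OF that \<zeta>] by (intro mult_mono) auto
    have "\<bar>(1 - \<nu>) * (agg_risk \<theta> - agg_risk \<eta>)\<bar> \<le> 1 * (L * b * ?S)"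
      unfolding abs_mult using \<nu> agg_risk_Lipschitz[OF that] by (intro mult_mono) auto
    with 1 2 show ?thesis unfolding H[OF that(1)] H[OF that(2)] by (simp add: algebra_simps)
  qed
  obtain \<eta> where \<eta>: "\<eta> \<in> \<Theta>" "\<And>\<theta>. \<theta> \<in> \<Theta> \<Longrightarrow> H \<eta> \<le> H \<theta>"
    using weight_simplex_attains_min[OF M_pos Hlip] by blast
  have growth: "4 * \<mu> * agg_dist \<theta> \<eta> \<le> H \<theta> - H \<eta>" if \<theta>: "\<theta> \<in> \<Theta>" for \<theta>
  \<comment> \<open>Minimality against the mixture with weight \<open>a\<close> on
    \<open>\<theta>\<close> yields the claim with an additional factor \<open>1 - a\<close>, called
    \<open>s\<close>. Letting \<open>s\<close> tend to 1 is the content of this rule.\<close>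
  proof (rule field_le_mult_one_interval)
    fix s :: real assume s: "0 < s" "s < 1"
    define a where "a = 1 - s"
    have a: "0 < a" "a < 1" using s by (auto simp: a_def)
    let ?c = "\<lambda>j. a * \<theta> j + (1 - a) * \<eta> j"
    have N: "0 \<le> agg_dist \<theta> \<eta>" by (simp add: agg_dist_def)
    have c: "?c \<in> \<Theta>" using a \<theta> \<eta> by (intro weight_simplex_combine) auto
    define X where "X = a * (1 - a) * agg_dist \<theta> \<eta>"
    have "pen_risk \<nu> \<kappa> ?c \<le> a * pen_risk \<nu> \<kappa> \<theta> + (1 - a) * pen_risk \<nu> \<kappa> \<eta> - (1 - \<nu>) * C * X / 2"
    proof -
      have "(1 - \<nu>) * agg_risk ?c \<le> (1 - \<nu>) * (a * agg_risk \<theta> + (1 - a) * agg_risk \<eta> - C / 2 * a * (1 - a) * agg_dist \<theta> \<eta>)"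
        using agg_risk_combine[OF \<theta> \<eta>(1) a] \<nu> by (intro mult_left_mono) auto
      also have "\<dots> = a * ((1 - \<nu>) * agg_risk \<theta>) + (1 - a) * ((1 - \<nu>) * agg_risk \<eta>) - (1 - \<nu>) * C * X / 2"
        by (simp add: X_def field_simps)
      finally have "(1 - \<nu>) * agg_risk ?c
        \<le> a * ((1 - \<nu>) * agg_risk \<theta>) + (1 - a) * ((1 - \<nu>) * agg_risk \<eta>) - (1 - \<nu>) * C * X / 2" .
      moreover have "(\<Sum>j=1..M. ?c j * (\<nu> * dict_risk j + \<kappa> j))
        = a * (\<Sum>j=1..M. \<theta> j * (\<nu> * dict_risk j + \<kappa> j)) + (1 - a) * (\<Sum>j=1..M. \<eta> j * (\<nu> * dict_risk j + \<kappa> j))"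
        unfolding sum_distrib_left sum.distrib[symmetric] by (intro sum.cong refl) (simp add: algebra_simps)
      ultimately show ?thesis unfolding pen_risk_def distrib_left by linarith
    qed
    \<comment> \<open>Strong convexity contributes at least \<open>5 * \<mu> * X\<close>, the
      concavity of \<open>agg_var\<close> takes back \<open>\<mu> * X\<close>, and 4
      remains.\<close>
    moreover have "10 * \<mu> * X \<le> (1 - \<nu>) * C * X"
      unfolding X_def using \<mu> a N by (intro mult_right_mono) auto
    moreover have "\<mu> * agg_var ?c = a * (\<mu> * agg_var \<theta>) + (1 - a) * (\<mu> * agg_var \<eta>) + \<mu> * X"
      using a by (subst agg_var_combine[OF \<theta> \<eta>(1)]) (auto simp: X_def algebra_simps)
    ultimately have "H ?c \<le> a * H \<theta> + (1 - a) * H \<eta> - 4 * \<mu> * X"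
      unfolding H_def distrib_left mult.assoc[of _ \<mu> X] by linarith
    hence "H ?c \<le> a * H \<theta> + (1 - a) * H \<eta> - 4 * \<mu> * (a * (1 - a) * agg_dist \<theta> \<eta>)"
      by (simp add: X_def)
    with \<eta>(2)[OF c] have "a * (4 * \<mu> * (1 - a) * agg_dist \<theta> \<eta>) \<le> a * (H \<theta> - H \<eta>)"
      by (simp add: algebra_simps)
    hence "4 * \<mu> * (1 - a) * agg_dist \<theta> \<eta> \<le> H \<theta> - H \<eta>" using a by simp
    thus "s * (4 * \<mu> * agg_dist \<theta> \<eta>) \<le> H \<theta> - H \<eta>" by (simp add: a_def mult_ac)
  qed
  show ?thesis
  proof (rule that[OF \<eta>(1)])
    fix j assume j: "j \<in> {1..M}"
    have "H (indicator {j}) = dict_risk j + \<kappa> j"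
      unfolding H_def pen_risk_def agg_risk_vertex[OF j] agg_var_vertex[OF j] sum_vertex[OF j]
      by (simp add: algebra_simps)
    with \<eta>(2)[OF weight_simplex_vertex[OF j]]
    show "pen_risk \<nu> \<kappa> \<eta> + \<mu> * agg_var \<eta> \<le> dict_risk j + \<kappa> j" by (simp add: H_def)
  next
    fix \<theta> assume "\<theta> \<in> \<Theta>"
    from growth[OF this]
    show "pen_risk \<nu> \<kappa> \<eta> + \<mu> * agg_var \<eta> + 4 * \<mu> * agg_dist \<theta> \<eta> \<le> pen_risk \<nu> \<kappa> \<theta> + \<mu> * agg_var \<theta>"
      by (simp add: H_def)
  qed
qed

text \<open>Strong convexity of the risk bounds the excess risk by the fluctuation \<open>A\<close>, and quadratic
  growth at \<open>\<eta>\<close> yields a second inequality in \<open>A\<close>; the bound is the first plus 3/4 of the second.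
  The weight 3/4 makes the constants in the lower bound on \<open>\<beta>\<close> suffice.\<close>
lemma excess_risk_le_fluctuation:
  assumes \<mu>: "10 * \<mu> \<le> \<nu> * C" and \<theta>: "\<theta> \<in> \<Theta>" and \<eta>: "\<eta> \<in> \<Theta>"
    and ref: "pen_risk \<nu> \<kappa> \<eta> + \<mu> * agg_var \<eta> \<le> r"
    and growth: "pen_risk \<nu> \<kappa> \<eta> + \<mu> * agg_var \<eta> + 4 * \<mu> * agg_dist \<theta> \<eta> \<le> pen_risk \<nu> \<kappa> \<theta> + \<mu> * agg_var \<theta>"
    and A: "pen_risk \<nu> \<kappa> \<theta> - pen_risk \<nu> \<kappa> \<eta> \<le> A" and \<mu>0: "0 < \<mu>" and \<nu>0: "0 < \<nu>"
  shows "agg_risk \<theta> - r \<le> 7/4 * A - 3 * \<mu> * (\<Sum>j=1..M. \<theta> j * dict_dist \<eta> j) - 7/4 * \<mu> * agg_var \<eta>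
           - (\<Sum>j=1..M. \<theta> j * \<kappa> j)"
proof -
  have "\<nu> * (agg_risk \<theta> + C / 2 * agg_var \<theta>) \<le> \<nu> * (\<Sum>j=1..M. \<theta> j * dict_risk j)"
    using agg_risk_le_mean_dict_risk[OF \<theta>] \<nu>0 by (intro mult_left_mono) auto
  moreover have "10 * \<mu> * agg_var \<theta> \<le> \<nu> * C * agg_var \<theta>"
    using \<mu> agg_var_nonneg[OF \<theta>] by (intro mult_right_mono) auto
  moreover have "pen_risk \<nu> \<kappa> \<theta> = (1 - \<nu>) * agg_risk \<theta> + \<nu> * (\<Sum>j=1..M. \<theta> j * dict_risk j) + (\<Sum>j=1..M. \<theta> j * \<kappa> j)"
    unfolding pen_risk_def sum_distrib_left add.assoc sum.distrib[symmetric]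
    by (intro arg_cong2[where f = "(+)"] sum.cong refl) (simp add: algebra_simps)
  ultimately have "agg_risk \<theta> + 5 * \<mu> * agg_var \<theta> + (\<Sum>j=1..M. \<theta> j * \<kappa> j) \<le> pen_risk \<nu> \<kappa> \<theta>"
    by (simp add: algebra_simps)
  moreover have "0 \<le> \<mu> * agg_var \<theta>" using \<mu>0 agg_var_nonneg[OF \<theta>] by simp
  moreover have "\<mu> * (\<Sum>j=1..M. \<theta> j * dict_dist \<eta> j) = \<mu> * agg_var \<theta> + \<mu> * agg_dist \<theta> \<eta>"
    using mean_dict_dist[OF \<theta> \<eta>] by (simp add: distrib_left)
  ultimately show ?thesis using ref growth A unfolding mult.assoc by linarith
qed

end

section \<open>Exponential moments of the empirical processes\<close>

text \<open>The Lagrange remainder is controlled by \<open>exp u \<le> 1 / (1 - u)\<close>. This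
  denominator produces the summand \<open>4 * \<mu> * b\<close> in the last lower bound on
  \<open>\<beta>\<close>.\<close>

lemma exp_le_quadratic:
  fixes u x :: real
  assumes "\<bar>x\<bar> \<le> u" "u < 1"
  shows "exp x \<le> 1 + x + x\<^sup>2 / (2 * (1 - u))"
proof -
  obtain t where t: "\<bar>t\<bar> \<le> \<bar>x\<bar>" "exp x = (\<Sum>m<2. x ^ m / fact m) + exp t / fact 2 * x ^ 2"
    using Maclaurin_exp_le[of x 2] by blast
  have "1 - u \<le> exp (- u)" using exp_ge_add_one_self[of "-u"] by simp
  hence "exp u \<le> 1 / (1 - u)" using assms by (simp add: exp_minus field_simps)
  moreover have "exp t \<le> exp u" using t assms by auto
  ultimately have "exp t \<le> 1 / (1 - u)" by (rule order_trans[rotated])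
  hence "exp t / 2 * x\<^sup>2 \<le> 1 / (1 - u) / 2 * x\<^sup>2"
    by (intro mult_right_mono divide_right_mono) auto
  moreover have "(\<Sum>m<2. x ^ m / fact m) = 1 + x"
    by (simp add: numeral_2_eq_2)
  ultimately show ?thesis using t(2) by (simp add: field_simps)
qed

text \<open>Odd Taylor terms cancel between \<open>x\<close> and \<open>-x\<close>, and on this
  range the fourth-order remainder costs at most \<open>x\<^sup>2 / 100\<close>. A leading constant
  so close to 1/2 is needed because the final estimate for \<open>c\<close> has little
  slack.\<close>

lemma cosh_le_quadratic:
  fixes x :: real
  assumes "\<bar>x\<bar> \<le> 7/25"
  shows "cosh x \<le> 1 + 51/100 * x\<^sup>2"
proof -
  have *: "exp y \<le> 1 + y + y\<^sup>2 / 2 + y ^ 3 / 6 + 1 / 100 * y\<^sup>2" if "\<bar>y\<bar> \<le> 7/25" for y :: real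
  proof -
    obtain t where t: "\<bar>t\<bar> \<le> \<bar>y\<bar>" "exp y = (\<Sum>m<4. y ^ m / fact m) + exp t / fact 4 * y ^ 4"
      using Maclaurin_exp_le[of y 4] by blast
    have "exp t \<le> 1 / (1 - 7/25)"
      using exp_ge_add_one_self[of "-t"] t that
      by (intro order_trans[of "exp t" "inverse (1 - t)" "1 / (1 - 7/25)"])
         (auto simp: exp_minus field_simps)
    moreover have "y\<^sup>2 \<le> (7/25)\<^sup>2" using that by (simp add: abs_le_square_iff[symmetric])
    ultimately have "exp t / 24 * y\<^sup>2 \<le> (1 / (1 - 7/25)) / 24 * (7/25)\<^sup>2"
      by (intro mult_mono divide_right_mono) auto
    hence "exp t / 24 * y\<^sup>2 * y\<^sup>2 \<le> 1 / 100 * y\<^sup>2"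
      by (intro mult_right_mono) (auto simp: power2_eq_square)
    moreover have "(\<Sum>m<4. y ^ m / fact m) = 1 + y + y\<^sup>2 / 2 + y ^ 3 / 6"
      by (simp add: eval_nat_numeral)
    ultimately show ?thesis using t(2) by (simp add: fact_numeral power2_eq_square power4_eq_xxxx mult.assoc)
  qed
  from *[of x] *[of "-x"] assms show ?thesis by (simp add: cosh_def)
qed

lemma ennreal_exp_mult_power: "ennreal (exp y) * ennreal (exp e) ^ k = ennreal (exp (y + real k * e))"
  by (simp add: ennreal_power exp_add exp_of_nat_mult flip: ennreal_mult)

section \<open>Nonlinear part: supremum of the aggregate deviations\<close>

context dictionary
begin

text \<open>Countability keeps the supremum in \<open>agg_process\<close> measurable. The
  extensional product fixes the values outside \<open>{1..M}\<close>; without this the set would be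
  uncountable.\<close>

definition rational_weights :: "(nat \<Rightarrow> real) set" where
  "rational_weights = \<Theta> \<inter> (\<Pi>\<^sub>E j\<in>{1..M}. \<rat>)"

lemma countable_rational_weights: "countable rational_weights"
  unfolding rational_weights_def by (intro countable_Int2 countable_PiE countable_rat) auto

text \<open>Coordinates 2 to \<open>M\<close> are rounded down to rationals and the first one
  receives the remaining mass. Rounding down keeps that mass nonnegative.\<close>

lemma rational_weights_dense:
  assumes \<theta>: "\<theta> \<in> \<Theta>"
  obtains t :: "nat \<Rightarrow> nat \<Rightarrow> real"
  where "\<And>k. t k \<in> rational_weights" "\<And>j. j \<in> {1..M} \<Longrightarrow> (\<lambda>k. t k j) \<longlonglongrightarrow> \<theta> j"
proof
  define q where "q k j = of_int \<lfloor>\<theta> j * real (Suc k)\<rfloor> / real (Suc k)" for k j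
  have split: "(\<Sum>j=1..M. w j) = w 1 + (\<Sum>j=2..M. w j)" for w :: "nat \<Rightarrow> real"
    using M_pos by (subst sum.atLeast_Suc_atMost) (auto simp: numeral_2_eq_2)
  have q: "\<theta> j - 1 / real (Suc k) \<le> q k j" "q k j \<le> \<theta> j" for k j
  proof -
    have "\<theta> j * real (Suc k) - 1 \<le> of_int \<lfloor>\<theta> j * real (Suc k)\<rfloor>" by linarith
    from divide_right_mono[OF this, of "real (Suc k)"]
    show "\<theta> j - 1 / real (Suc k) \<le> q k j" unfolding q_def diff_divide_distrib by simp
    have "of_int \<lfloor>\<theta> j * real (Suc k)\<rfloor> \<le> \<theta> j * real (Suc k)" by linarith
    from divide_right_mono[OF this, of "real (Suc k)"]
    show "q k j \<le> \<theta> j" unfolding q_def by simp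
  qed
  have q0: "0 \<le> q k j" if "j \<in> {1..M}" for k j
    using \<theta> that by (simp add: q_def weight_simplex_def)
  define t where "t k j = (if j \<in> {1..M} then if j = 1 then 1 - (\<Sum>i=2..M. q k i) else q k j else undefined)" for k j
  have t1: "t k 1 = 1 - (\<Sum>i=2..M. q k i)" for k using M_pos by (simp add: t_def)
  have t2: "(\<Sum>i=2..M. t k i) = (\<Sum>i=2..M. q k i)" for k
    by (intro sum.cong) (auto simp: t_def)
  have \<theta>1: "\<theta> 1 = 1 - (\<Sum>i=2..M. \<theta> i)" using \<theta> split[of \<theta>] by (simp add: weight_simplex_def)
  show "t k \<in> rational_weights" for k
  proof -
    have "(\<Sum>i=2..M. q k i) \<le> (\<Sum>i=2..M. \<theta> i)" by (intro sum_mono q)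
    also have "\<dots> \<le> 1"
    proof -
      have "0 \<le> \<theta> 1" using \<theta> M_pos unfolding weight_simplex_def by fastforce
      thus ?thesis using \<theta>1 by linarith
    qed
    finally have "0 \<le> t k j" if "j \<in> {1..M}" for j
      using that q0 by (auto simp: t_def)
    moreover have "(\<Sum>j=1..M. t k j) = 1" unfolding split t1 t2 by simp
    moreover have "q k j \<in> \<rat>" for j unfolding q_def by simp
    hence "t k \<in> (\<Pi>\<^sub>E j\<in>{1..M}. \<rat>)" by (auto simp: t_def intro!: Rats_diff Rats_sum)
    ultimately show ?thesis by (auto simp: rational_weights_def weight_simplex_def)
  qed
  have qlim: "(\<lambda>k. q k j) \<longlonglongrightarrow> \<theta> j" for j
  proof (rule tendsto_sandwich)
    show "(\<lambda>k. \<theta> j - 1 / real (Suc k)) \<longlonglongrightarrow> \<theta> j"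
      using tendsto_diff[OF tendsto_const LIMSEQ_Suc[OF lim_1_over_n], of "\<theta> j"] by simp
  qed (use q in auto)
  fix j assume j: "j \<in> {1..M}"
  show "(\<lambda>k. t k j) \<longlonglongrightarrow> \<theta> j"
  proof (cases "j = 1")
    case True
    have "(\<lambda>k. 1 - (\<Sum>i=2..M. q k i)) \<longlonglongrightarrow> 1 - (\<Sum>i=2..M. \<theta> i)"
      by (intro tendsto_intros qlim)
    thus ?thesis using True t1 \<theta>1 by simp
  next
    case False
    with j qlim show ?thesis by (simp add: t_def)
  qed
qed

lemma agg_risk_tendsto:
  assumes t: "\<And>k. t k \<in> \<Theta>" "\<And>j. j \<in> {1..M} \<Longrightarrow> (\<lambda>k. t k j) \<longlonglongrightarrow> \<theta> j" and \<theta>: "\<theta> \<in> \<Theta>"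
  shows "(\<lambda>k. agg_risk (t k)) \<longlonglongrightarrow> agg_risk \<theta>"
proof -
  have "(\<lambda>k. L * b * (\<Sum>j=1..M. \<bar>t k j - \<theta> j\<bar>)) \<longlonglongrightarrow> L * b * (\<Sum>j=1..M. \<bar>\<theta> j - \<theta> j\<bar>)"
    by (intro tendsto_intros t(2))
  hence "(\<lambda>k. L * b * (\<Sum>j=1..M. \<bar>t k j - \<theta> j\<bar>)) \<longlonglongrightarrow> 0" by simp
  hence "(\<lambda>k. agg_risk (t k) - agg_risk \<theta>) \<longlonglongrightarrow> 0"
  proof (rule Lim_null_comparison[rotated], intro always_eventually allI)
    show "norm (agg_risk (t k) - agg_risk \<theta>) \<le> L * b * (\<Sum>j=1..M. \<bar>t k j - \<theta> j\<bar>)" for k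
      unfolding real_norm_def by (intro agg_risk_Lipschitz t(1) \<theta>)
  qed
  thus ?thesis by (simp add: LIM_zero_iff)
qed

lemma G_agg_tendsto:
  assumes t: "\<And>k. t k \<in> \<Theta>" "\<And>j. j \<in> {1..M} \<Longrightarrow> (\<lambda>k. t k j) \<longlonglongrightarrow> \<theta> j" and \<theta>: "\<theta> \<in> \<Theta>"
    and z: "good z"
  shows "(\<lambda>k. G z (agg (t k) z)) \<longlonglongrightarrow> G z (agg \<theta> z)"
proof -
  have "(\<lambda>k. agg (t k) z) \<longlonglongrightarrow> agg \<theta> z"
    unfolding f_agg_def by (intro tendsto_intros t(2))
  hence "(\<lambda>k. L * \<bar>agg (t k) z - agg \<theta> z\<bar>) \<longlonglongrightarrow> L * \<bar>agg \<theta> z - agg \<theta> z\<bar>"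
    by (intro tendsto_intros)
  hence "(\<lambda>k. L * \<bar>agg (t k) z - agg \<theta> z\<bar>) \<longlonglongrightarrow> 0" by simp
  hence "(\<lambda>k. G z (agg (t k) z) - G z (agg \<theta> z)) \<longlonglongrightarrow> 0"
  proof (rule Lim_null_comparison[rotated], intro always_eventually allI)
    show "norm (G z (agg (t k) z) - G z (agg \<theta> z)) \<le> L * \<bar>agg (t k) z - agg \<theta> z\<bar>" for k
      unfolding real_norm_def by (intro good_Lipschitz agg_bounded t(1) \<theta> z)
  qed
  thus ?thesis by (simp add: LIM_zero_iff)
qed

definition agg_deviation :: "(nat \<Rightarrow> real) \<Rightarrow> (nat \<Rightarrow> real) \<Rightarrow> 'z \<Rightarrow> real" where
  "agg_deviation \<eta> \<theta> z = (agg_risk \<theta> - agg_risk \<eta>) - (G z (agg \<theta> z) - G z (agg \<eta> z))"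

text \<open>The offset \<open>y\<close> leaves room for the log prior and for variance terms
  subtracted in advance.\<close>

definition agg_process ::
  "(nat \<Rightarrow> real) \<Rightarrow> real \<Rightarrow> (nat \<Rightarrow> real) \<Rightarrow> 'i set \<Rightarrow> ('i \<Rightarrow> 'z) \<Rightarrow> ennreal" where
  "agg_process \<eta> c y I z = (SUP t\<in>rational_weights.
      ennreal (exp ((\<Sum>j=1..M. t j * y j) + c * (\<Sum>i\<in>I. agg_deviation \<eta> t (z i)))))"

lemma agg_deviation_measurable: "agg_deviation \<eta> t \<in> borel_measurable P"
  unfolding agg_deviation_def[abs_def] by (intro borel_measurable_diff borel_measurable_const G_measurable) auto

lemma agg_process_measurable:
  fixes I :: "'i set"
  shows "agg_process \<eta> c y I \<in> borel_measurable (PiM I (\<lambda>_. P))"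
proof -
  have m: "(\<lambda>z. agg_deviation \<eta> t (z i)) \<in> borel_measurable (PiM I (\<lambda>_. P))" if "i \<in> I" for t i
    using measurable_compose[OF measurable_component_singleton[OF that] agg_deviation_measurable] .
  show ?thesis unfolding agg_process_def[abs_def] using countable_rational_weights
    by (intro borel_measurable_SUP) (auto intro!: borel_measurable_add borel_measurable_times
       borel_measurable_sum m measurable_compose[OF _ borel_measurable_exp]
       measurable_compose[OF _ measurable_ennreal])
qed

text \<open>By continuity in the weights at good observations, the countable supremum also dominates
  real weights, in particular data-dependent ones.\<close>

lemma exp_le_agg_process:
  assumes \<theta>: "\<theta> \<in> \<Theta>" and z: "\<And>i. i \<in> I \<Longrightarrow> good (z i)"
  shows "ennreal (exp ((\<Sum>j=1..M. \<theta> j * y j) + c * (\<Sum>i\<in>I. agg_deviation \<eta> \<theta> (z i)))) \<le> agg_process \<eta> c y I z"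
proof -
  obtain t where t: "\<And>k. t k \<in> rational_weights" "\<And>j. j \<in> {1..M} \<Longrightarrow> (\<lambda>k. t k j) \<longlonglongrightarrow> \<theta> j"
    using rational_weights_dense[OF \<theta>] by blast
  have t\<Theta>: "t k \<in> \<Theta>" for k using t(1) by (simp add: rational_weights_def)
  have "(\<lambda>k. (\<Sum>j=1..M. t k j * y j) + c * (\<Sum>i\<in>I. agg_deviation \<eta> (t k) (z i)))
    \<longlonglongrightarrow> (\<Sum>j=1..M. \<theta> j * y j) + c * (\<Sum>i\<in>I. agg_deviation \<eta> \<theta> (z i))"
    unfolding agg_deviation_def
    by (intro tendsto_intros agg_risk_tendsto G_agg_tendsto t\<Theta> t(2) \<theta> z)
  hence "(\<lambda>k. ennreal (exp ((\<Sum>j=1..M. t k j * y j) + c * (\<Sum>i\<in>I. agg_deviation \<eta> (t k) (z i)))))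
    \<longlonglongrightarrow> ennreal (exp ((\<Sum>j=1..M. \<theta> j * y j) + c * (\<Sum>i\<in>I. agg_deviation \<eta> \<theta> (z i))))"
    by (intro tendsto_ennrealI tendsto_exp)
  thus ?thesis
    by (rule LIMSEQ_le_const2) (auto simp: agg_process_def intro!: SUP_upper t(1))
qed

text \<open>The argument of \<open>cosh\<close> is at most \<open>4 * c * L * b\<close>, as both
  functions are bounded by \<open>b\<close>. The constant 51/25 is 51/100 times the square of the
  factor 2 that symmetrization introduced.\<close>

lemma nn_integral_cosh_le:
  assumes j: "j \<in> {1..M}" and \<eta>: "\<eta> \<in> \<Theta>" and c: "0 \<le> c" "4 * c * L * b \<le> 7/25"
  shows "(\<integral>\<^sup>+ z. ennreal (cosh (2 * c * (L * (F j z - agg \<eta> z)))) \<partial>P)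
       \<le> ennreal (exp (51/25 * c\<^sup>2 * L\<^sup>2 * dict_dist \<eta> j))"
proof -
  have "(\<integral>\<^sup>+ z. ennreal (cosh (2 * c * (L * (F j z - agg \<eta> z)))) \<partial>P)
      \<le> (\<integral>\<^sup>+ z. ennreal (1 + 51/25 * c\<^sup>2 * L\<^sup>2 * (F j z - agg \<eta> z)\<^sup>2) \<partial>P)"
  proof (rule nn_integral_mono_AE)
    show "AE z in P. ennreal (cosh (2 * c * (L * (F j z - agg \<eta> z))))
      \<le> ennreal (1 + 51/25 * c\<^sup>2 * L\<^sup>2 * (F j z - agg \<eta> z)\<^sup>2)"
      using AE_good
    proof eventually_elim
      case (elim z)
      have "\<bar>F j z - agg \<eta> z\<bar> \<le> 2 * b" using good_bounded[OF elim j] agg_bounded[OF elim \<eta>] by auto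
      hence "2 * c * L * \<bar>F j z - agg \<eta> z\<bar> \<le> 2 * c * L * (2 * b)"
        using c L_pos by (intro mult_left_mono) auto
      moreover have "2 * c * L * (2 * b) = 4 * c * L * b" by simp
      moreover have "\<bar>2 * c * (L * (F j z - agg \<eta> z))\<bar> = 2 * c * L * \<bar>F j z - agg \<eta> z\<bar>"
        using c L_pos by (simp add: abs_mult)
      ultimately have "\<bar>2 * c * (L * (F j z - agg \<eta> z))\<bar> \<le> 7/25"
        using c by linarith
      from cosh_le_quadratic[OF this]
      have "cosh (2 * c * (L * (F j z - agg \<eta> z))) \<le> 1 + 51/25 * c\<^sup>2 * L\<^sup>2 * (F j z - agg \<eta> z)\<^sup>2"
        unfolding power_mult_distrib by (simp add: mult_ac)
      thus ?case by (rule ennreal_leI)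
    qed
  qed
  also have "\<dots> = ennreal (\<integral>z. 1 + 51/25 * c\<^sup>2 * L\<^sup>2 * (F j z - agg \<eta> z)\<^sup>2 \<partial>P)"
    using integrable_dict_sq[OF \<eta> j] by (intro nn_integral_eq_integral) auto
  also have "(\<integral>z. 1 + 51/25 * c\<^sup>2 * L\<^sup>2 * (F j z - agg \<eta> z)\<^sup>2 \<partial>P) = 1 + 51/25 * c\<^sup>2 * L\<^sup>2 * dict_dist \<eta> j"
    using integrable_dict_sq[OF \<eta> j] by (simp add: dict_dist_def prob_space)
  finally show ?thesis
    by (rule order_trans) (intro ennreal_leI, simp)
qed

lemma nn_integral_agg_process_le:
  fixes I :: "'i set"
  assumes \<eta>: "\<eta> \<in> \<Theta>" and c: "0 \<le> c" "4 * c * L * b \<le> 7/25" and I: "finite I"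
  shows "(\<integral>\<^sup>+ z. agg_process \<eta> c y I z \<partial>(PiM I (\<lambda>_. P)))
       \<le> (\<Sum>j=1..M. ennreal (exp (y j + real (card I) * (51/25 * c\<^sup>2 * L\<^sup>2 * dict_dist \<eta> j))))"
proof -
  define g where "g t z = G z (agg t z) - G z (agg \<eta> z)" for t z
  \<comment> \<open>The mean of \<open>h\<close> under weights \<open>t\<close> is
    \<open>L * (agg t z - agg \<eta> z)\<close>. By the Lipschitz condition it dominates
    \<open>g t z\<close>, and its increments dominate those of \<open>g\<close>.\<close>
  define h where "h j z = L * (F j z - agg \<eta> z)" for j z
  have T: "t \<in> \<Theta>" if "t \<in> rational_weights" for t using that by (simp add: rational_weights_def)
  have g_int: "integrable P (g t)" if "t \<in> rational_weights" for t
    unfolding g_def by (intro Bochner_Integration.integrable_diff integrable_agg_risk T that \<eta>)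
  have Eg: "expectation (g t) = agg_risk t - agg_risk \<eta>" if "t \<in> rational_weights" for t
    unfolding g_def agg_risk_def by (intro Bochner_Integration.integral_diff integrable_agg_risk T that \<eta>)
  have lin: "(\<Sum>j=1..M. t j * h j z) = L * (agg t z - agg \<eta> z)" if "t \<in> rational_weights" for t z
  proof -
    have "(\<Sum>j=1..M. t j * h j z) = (\<Sum>j=1..M. L * (t j * F j z) - t j * (L * agg \<eta> z))"
      by (intro sum.cong) (auto simp: h_def algebra_simps)
    also have "\<dots> = L * agg t z - (\<Sum>j=1..M. t j) * (L * agg \<eta> z)"
      by (simp add: sum_subtractf f_agg_def[of F M t] sum_distrib_left sum_distrib_right)
    finally show ?thesis using T[OF that] by (simp add: weight_simplex_def algebra_simps)
  qed
  have "(\<integral>\<^sup>+ z. agg_process \<eta> c y I z \<partial>(PiM I (\<lambda>_. P)))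
    = (\<integral>\<^sup>+ z. (SUP t\<in>rational_weights. ennreal (exp ((\<Sum>j\<in>{1..M}. t j * y j)
             + c * (\<Sum>i\<in>I. expectation (g t) - g t (z i))))) \<partial>(PiM I (\<lambda>_. P)))"
    unfolding agg_process_def by (intro nn_integral_cong SUP_cong refl) (simp add: Eg agg_deviation_def g_def)
  also have "\<dots> \<le> (\<Sum>j\<in>{1..M}. ennreal (exp (y j)) * (\<integral>\<^sup>+ z. ennreal (cosh (2 * c * h j z)) \<partial>P) ^ card I)"
  proof (rule symmetrization_contraction_PiM[OF countable_rational_weights _ _ _ g_int _ _ I])
    show "0 \<le> t j" if "t \<in> rational_weights" "j \<in> {1..M}" for t j
      using T[OF that(1)] that(2) by (simp add: weight_simplex_def)
    show "(\<Sum>j\<in>{1..M}. t j) = 1" if "t \<in> rational_weights" for t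
      using T[OF that(1)] by (simp add: weight_simplex_def)
    show "h j \<in> borel_measurable P" if "j \<in> {1..M}" for j
      using that unfolding h_def by measurable
    show "AE z in P. (\<forall>t\<in>rational_weights. \<bar>g t z\<bar> \<le> \<bar>\<Sum>j\<in>{1..M}. t j * h j z\<bar>) \<and>
           (\<forall>s\<in>rational_weights. \<forall>t\<in>rational_weights.
              \<bar>g s z - g t z\<bar> \<le> \<bar>(\<Sum>j\<in>{1..M}. s j * h j z) - (\<Sum>j\<in>{1..M}. t j * h j z)\<bar>)"
      using AE_good
    proof eventually_elim
      case (elim z)
      have "\<bar>G z (agg s z) - G z (agg t z)\<bar> \<le> \<bar>L * (agg s z - agg t z)\<bar>" if "s \<in> \<Theta>" "t \<in> \<Theta>" for s t
        using good_Lipschitz[OF elim agg_bounded[OF elim that(1)] agg_bounded[OF elim that(2)]] L_pos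
        by (simp add: abs_mult)
      thus ?case using T \<eta> by (auto simp: lin g_def simp del: One_nat_def simp flip: right_diff_distrib)
    qed
  qed auto
  also have "\<dots> \<le> (\<Sum>j\<in>{1..M}. ennreal (exp (y j)) * ennreal (exp (51/25 * c\<^sup>2 * L\<^sup>2 * dict_dist \<eta> j)) ^ card I)"
    unfolding h_def by (intro sum_mono mult_left_mono power_mono nn_integral_cosh_le \<eta> c) auto
  also have "\<dots> = (\<Sum>j\<in>{1..M}. ennreal (exp (y j + real (card I) * (51/25 * c\<^sup>2 * L\<^sup>2 * dict_dist \<eta> j))))"
    unfolding ennreal_exp_mult_power ..
  finally show ?thesis .
qed

section \<open>Linear part: Bernstein bounds for dictionary losses\<close>

definition dict_deviation :: "(nat \<Rightarrow> real) \<Rightarrow> nat \<Rightarrow> 'z \<Rightarrow> real" where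
  "dict_deviation \<eta> j z = (dict_risk j - (\<Sum>i=1..M. \<eta> i * dict_risk i))
     - (G z (F j z) - (\<Sum>i=1..M. \<eta> i * G z (F i z)))"

lemma G_F_measurable: "j \<in> {1..M} \<Longrightarrow> (\<lambda>z. G z (F j z)) \<in> borel_measurable P"
  by (intro G_measurable F_meas)

lemma dict_deviation_measurable: "j \<in> {1..M} \<Longrightarrow> dict_deviation \<eta> j \<in> borel_measurable P"
  unfolding dict_deviation_def[abs_def]
  by (intro borel_measurable_diff borel_measurable_const borel_measurable_sum borel_measurable_times G_F_measurable)

text \<open>A Bernstein bound for the loss of \<open>F j\<close> minus the
  \<open>\<eta>\<close>-mean of the dictionary losses. This difference is at most
  \<open>2 * L * b\<close> in absolute value. Its second moment compares \<open>F j\<close> with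
  each \<open>F i\<close> separately and not with \<open>agg \<eta>\<close>, hence the summand
  \<open>agg_var \<eta>\<close>.\<close>

lemma nn_integral_exp_dict_deviation_le:
  assumes j: "j \<in> {1..M}" and \<eta>: "\<eta> \<in> \<Theta>" and t: "0 \<le> t" "2 * t * L * b < 1"
  shows "(\<integral>\<^sup>+ z. ennreal (exp (t * dict_deviation \<eta> j z)) \<partial>P)
    \<le> ennreal (exp (t\<^sup>2 * L\<^sup>2 * (dict_dist \<eta> j + agg_var \<eta>) / (2 * (1 - 2 * t * L * b))))"
proof -
  define k where "k z = G z (F j z) - (\<Sum>i=1..M. \<eta> i * G z (F i z))" for z
  define e where "e = dict_risk j - (\<Sum>i=1..M. \<eta> i * dict_risk i)"
  define u where "u = 2 * t * L * b"
  \<comment> \<open>By the bias-variance decomposition this is the \<open>\<eta>\<close>-mean of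
    \<open>(F i z - F j z)\<^sup>2\<close>.\<close>
  define q where "q z = (F j z - agg \<eta> z)\<^sup>2 + (\<Sum>i=1..M. \<eta> i * (F i z - agg \<eta> z)\<^sup>2)" for z
  have u: "u < 1" using t by (simp add: u_def)
  have k_int: "integrable P k" unfolding k_def
    by (intro Bochner_Integration.integrable_diff Bochner_Integration.integrable_sum integrable_mult_right G_F_integrable j)
  have "expectation (\<lambda>z. \<Sum>i=1..M. \<eta> i * G z (F i z)) = (\<Sum>i=1..M. \<eta> i * dict_risk i)"
    unfolding dict_risk_def
    by (subst Bochner_Integration.integral_sum) (auto intro!: integrable_mult_right G_F_integrable)
  hence Ek: "expectation k = e" unfolding k_def e_def dict_risk_def
    by (subst Bochner_Integration.integral_diff)
       (simp_all only: Bochner_Integration.integrable_sum integrable_mult_right G_F_integrable j)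
  have q_int: "integrable P q" unfolding q_def
    by (intro Bochner_Integration.integrable_add integrable_dict_sq integrable_mean_dict_sq \<eta> j)
  have Eq: "expectation q = dict_dist \<eta> j + agg_var \<eta>"
    unfolding q_def using integrable_dict_sq[OF \<eta> j] integrable_mean_dict_sq[OF \<eta> \<eta>] expectation_mean_dict_sq[OF \<eta> \<eta>]
    by (subst Bochner_Integration.integral_add) (auto simp: agg_var_def dict_dist_def)
  have \<eta>': "\<And>i. i \<in> {1..M} \<Longrightarrow> 0 \<le> \<eta> i" "(\<Sum>i=1..M. \<eta> i) = 1"
    using \<eta> by (auto simp: weight_simplex_def)
  have pt: "exp (- (t * k z)) \<le> 1 - t * k z + t\<^sup>2 * L\<^sup>2 / (2 * (1 - u)) * q z" if z: "good z" for z
  proof -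
    have k: "k z = (\<Sum>i=1..M. \<eta> i * (G z (F j z) - G z (F i z)))"
      using \<eta>'(2) by (simp add: k_def right_diff_distrib sum_subtractf flip: sum_distrib_right)
    have lip: "\<bar>G z (F j z) - G z (F i z)\<bar> \<le> L * \<bar>F j z - F i z\<bar>" if "i \<in> {1..M}" for i
      by (intro good_Lipschitz z good_bounded j that)
    have F2: "\<bar>F j z - F i z\<bar> \<le> 2 * b" if "i \<in> {1..M}" for i
      using good_bounded[OF z j] good_bounded[OF z that] by auto
    have "\<bar>k z\<bar> \<le> L * (2 * b)" unfolding k
    proof (rule weight_simplex_mean_bound[OF \<eta>])
      fix i assume i: "i \<in> {1..M}"
      show "\<bar>G z (F j z) - G z (F i z)\<bar> \<le> L * (2 * b)"
        using lip[OF i] mult_left_mono[OF F2[OF i], of L] L_pos by linarith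
    qed
    hence "t * \<bar>k z\<bar> \<le> u" using mult_left_mono[of "\<bar>k z\<bar>" "L * (2 * b)" t] t by (simp add: u_def mult_ac)
    hence "\<bar>- (t * k z)\<bar> \<le> u" using t by (simp add: abs_mult)
    from exp_le_quadratic[OF this u]
    have "exp (- (t * k z)) \<le> 1 - t * k z + t\<^sup>2 / (2 * (1 - u)) * (k z)\<^sup>2" by (simp add: power_mult_distrib)
    also have "t\<^sup>2 / (2 * (1 - u)) * (k z)\<^sup>2 \<le> t\<^sup>2 / (2 * (1 - u)) * (L\<^sup>2 * q z)"
    proof (intro mult_left_mono)
      let ?w = "\<lambda>i. G z (F j z) - G z (F i z)"
      have "(k z)\<^sup>2 \<le> (\<Sum>i=1..M. \<eta> i * (?w i)\<^sup>2)"
        using weight_simplex_mean_square[OF \<eta>, of ?w 0] \<eta>'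
        by (auto simp: k intro!: sum_nonneg mult_nonneg_nonneg)
      also have "\<dots> \<le> (\<Sum>i=1..M. \<eta> i * (L\<^sup>2 * (F i z - F j z)\<^sup>2))"
      proof (intro sum_mono mult_left_mono \<eta>')
        fix i assume i: "i \<in> {1..M}"
        have "\<bar>?w i\<bar> \<le> \<bar>L * (F i z - F j z)\<bar>"
          using lip[OF i] L_pos by (simp add: abs_mult abs_minus_commute)
        thus "(?w i)\<^sup>2 \<le> L\<^sup>2 * (F i z - F j z)\<^sup>2" by (simp add: abs_le_square_iff power_mult_distrib)
      qed
      also have "\<dots> = L\<^sup>2 * (\<Sum>i=1..M. \<eta> i * (F i z - F j z)\<^sup>2)"
        by (simp add: sum_distrib_left mult_ac)
      also have "(\<Sum>i=1..M. \<eta> i * (F i z - F j z)\<^sup>2) = q z"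
        unfolding weight_simplex_mean_square[OF \<eta>, of "\<lambda>i. F i z" "F j z"] q_def f_agg_def
        by (simp add: power2_commute)
      finally show "(k z)\<^sup>2 \<le> L\<^sup>2 * q z" .
    qed (use u in auto)
    finally show ?thesis by simp
  qed
  have "(\<integral>\<^sup>+ z. ennreal (exp (t * dict_deviation \<eta> j z)) \<partial>P)
     \<le> (\<integral>\<^sup>+ z. ennreal (exp (t * e) * (1 - t * k z + t\<^sup>2 * L\<^sup>2 / (2 * (1 - u)) * q z)) \<partial>P)"
  proof (rule nn_integral_mono_AE)
    show "AE z in P. ennreal (exp (t * dict_deviation \<eta> j z))
      \<le> ennreal (exp (t * e) * (1 - t * k z + t\<^sup>2 * L\<^sup>2 / (2 * (1 - u)) * q z))"
      using AE_good
    proof eventually_elim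
      case (elim z)
      have "exp (t * dict_deviation \<eta> j z) = exp (t * e) * exp (- (t * k z))"
        by (simp add: dict_deviation_def e_def k_def algebra_simps flip: exp_add)
      thus ?case using pt[OF elim] by (auto intro!: ennreal_leI)
    qed
  qed
  also have "\<dots> = ennreal (\<integral>z. exp (t * e) * (1 - t * k z + t\<^sup>2 * L\<^sup>2 / (2 * (1 - u)) * q z) \<partial>P)"
  proof (rule nn_integral_eq_integral)
    show "integrable P (\<lambda>z. exp (t * e) * (1 - t * k z + t\<^sup>2 * L\<^sup>2 / (2 * (1 - u)) * q z))"
      using k_int q_int by (intro integrable_mult_right Bochner_Integration.integrable_add Bochner_Integration.integrable_diff) auto
    show "AE z in P. 0 \<le> exp (t * e) * (1 - t * k z + t\<^sup>2 * L\<^sup>2 / (2 * (1 - u)) * q z)"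
      using AE_good by eventually_elim (intro mult_nonneg_nonneg exp_ge_zero order_trans[OF exp_ge_zero pt])
  qed
  also have "(\<integral>z. exp (t * e) * (1 - t * k z + t\<^sup>2 * L\<^sup>2 / (2 * (1 - u)) * q z) \<partial>P)
     = exp (t * e) * (1 - t * e + t\<^sup>2 * L\<^sup>2 / (2 * (1 - u)) * (dict_dist \<eta> j + agg_var \<eta>))"
    using k_int q_int by (simp add: Ek Eq prob_space)
  \<comment> \<open>The function \<open>k\<close> is not centred, but its mean \<open>e\<close>
    enters with the factor \<open>exp (t * e)\<close>, and \<open>1 + v \<le> exp v\<close> cancels
    it.\<close>
  also have "\<dots> \<le> exp (t * e) * exp (- (t * e) + t\<^sup>2 * L\<^sup>2 / (2 * (1 - u)) * (dict_dist \<eta> j + agg_var \<eta>))"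
  proof (intro mult_left_mono)
    show "1 - t * e + t\<^sup>2 * L\<^sup>2 / (2 * (1 - u)) * (dict_dist \<eta> j + agg_var \<eta>)
      \<le> exp (- (t * e) + t\<^sup>2 * L\<^sup>2 / (2 * (1 - u)) * (dict_dist \<eta> j + agg_var \<eta>))"
      using exp_ge_add_one_self[of "- (t * e) + t\<^sup>2 * L\<^sup>2 / (2 * (1 - u)) * (dict_dist \<eta> j + agg_var \<eta>)"]
      by linarith
  qed simp
  also have "\<dots> = exp (t\<^sup>2 * L\<^sup>2 * (dict_dist \<eta> j + agg_var \<eta>) / (2 * (1 - 2 * t * L * b)))"
    by (simp add: u_def flip: exp_add)
  finally show ?thesis by (simp add: ennreal_leI)
qed

lemma dict_deviation_component_measurable:
  assumes "i \<in> I" "j \<in> {1..M}"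
  shows "(\<lambda>z. dict_deviation \<eta> j (z i)) \<in> borel_measurable (PiM I (\<lambda>_. P))"
  using measurable_compose[OF measurable_component_singleton[OF assms(1)] dict_deviation_measurable[OF assms(2)]] .

text \<open>A sum over vertices replaces the supremum, since this part is already linear in the
  weights. In product form, independence factorizes the integral.\<close>

definition dict_process ::
  "(nat \<Rightarrow> real) \<Rightarrow> real \<Rightarrow> (nat \<Rightarrow> real) \<Rightarrow> 'i set \<Rightarrow> ('i \<Rightarrow> 'z) \<Rightarrow> ennreal" where
  "dict_process \<eta> t y I z = (\<Sum>j=1..M. ennreal (exp (y j)) * (\<Prod>i\<in>I. ennreal (exp (t * dict_deviation \<eta> j (z i)))))"

lemma dict_process_measurable:
  fixes I :: "'i set"
  shows "dict_process \<eta> t y I \<in> borel_measurable (PiM I (\<lambda>_. P))"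
  unfolding dict_process_def[abs_def]
    by (intro borel_measurable_sum borel_measurable_times_ennreal borel_measurable_prod_ennreal borel_measurable_const
          measurable_compose[OF _ borel_measurable_exp] measurable_compose[OF _ measurable_ennreal]
          borel_measurable_times dict_deviation_component_measurable)

lemma exp_le_dict_process:
  assumes \<theta>: "\<theta> \<in> \<Theta>" and I: "finite I"
  shows "ennreal (exp ((\<Sum>j=1..M. \<theta> j * y j) + t * (\<Sum>i\<in>I. \<Sum>j=1..M. \<theta> j * dict_deviation \<eta> j (z i))))
    \<le> dict_process \<eta> t y I z"
proof -
  have "(\<Sum>j=1..M. \<theta> j * y j) + t * (\<Sum>i\<in>I. \<Sum>j=1..M. \<theta> j * dict_deviation \<eta> j (z i))
     = (\<Sum>j=1..M. \<theta> j * (y j + (\<Sum>i\<in>I. t * dict_deviation \<eta> j (z i))))"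
    by (subst sum.swap) (simp add: distrib_left sum.distrib sum_distrib_left mult_ac)
  also have "exp \<dots> \<le> (\<Sum>j=1..M. exp (y j + (\<Sum>i\<in>I. t * dict_deviation \<eta> j (z i))))"
    using \<theta> by (intro exp_convex_combination_le_sum) (auto simp: weight_simplex_def)
  also have "\<dots> = (\<Sum>j=1..M. exp (y j) * (\<Prod>i\<in>I. exp (t * dict_deviation \<eta> j (z i))))"
    using I by (simp add: exp_add exp_sum)
  finally show ?thesis
    by (simp add: dict_process_def prod_ennreal prod_nonneg ennreal_leI flip: ennreal_mult)
qed

lemma nn_integral_dict_process_le:
  fixes I :: "'i set"
  assumes \<eta>: "\<eta> \<in> \<Theta>" and t: "0 \<le> t" "2 * t * L * b < 1" and I: "finite I"
  shows "(\<integral>\<^sup>+ z. dict_process \<eta> t y I z \<partial>(PiM I (\<lambda>_. P)))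
     \<le> (\<Sum>j=1..M. ennreal (exp (y j + real (card I) * (t\<^sup>2 * L\<^sup>2 * (dict_dist \<eta> j + agg_var \<eta>) / (2 * (1 - 2 * t * L * b))))))"
proof -
  interpret pp: product_sigma_finite "\<lambda>_::'i. P" by standard
  have m: "(\<lambda>z. \<Prod>i\<in>I. ennreal (exp (t * dict_deviation \<eta> j (z i)))) \<in> borel_measurable (PiM I (\<lambda>_. P))"
    if "j \<in> {1..M}" for j
    by (intro borel_measurable_prod_ennreal measurable_compose[OF _ borel_measurable_exp]
          measurable_compose[OF _ measurable_ennreal] borel_measurable_times borel_measurable_const
          dict_deviation_component_measurable that)
  have m': "(\<lambda>z. ennreal (exp (t * dict_deviation \<eta> j z))) \<in> borel_measurable P" if "j \<in> {1..M}" for j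
    by (intro measurable_compose[OF _ borel_measurable_exp]
          measurable_compose[OF _ measurable_ennreal] borel_measurable_times borel_measurable_const
          dict_deviation_measurable that)
  have "(\<integral>\<^sup>+ z. dict_process \<eta> t y I z \<partial>(PiM I (\<lambda>_. P)))
     = (\<Sum>j=1..M. \<integral>\<^sup>+ z. ennreal (exp (y j)) * (\<Prod>i\<in>I. ennreal (exp (t * dict_deviation \<eta> j (z i)))) \<partial>(PiM I (\<lambda>_. P)))"
    unfolding dict_process_def using m by (intro nn_integral_sum) auto
  also have "\<dots> = (\<Sum>j=1..M. ennreal (exp (y j)) * (\<integral>\<^sup>+ z. ennreal (exp (t * dict_deviation \<eta> j z)) \<partial>P) ^ card I)"
  proof (intro sum.cong refl)
    fix j assume j: "j \<in> {1..M}"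
    have "(\<integral>\<^sup>+ z. (\<Prod>i\<in>I. ennreal (exp (t * dict_deviation \<eta> j (z i)))) \<partial>(PiM I (\<lambda>_. P)))
      = (\<Prod>i\<in>I. \<integral>\<^sup>+ z. ennreal (exp (t * dict_deviation \<eta> j z)) \<partial>P)"
      by (intro pp.product_nn_integral_prod I m' j)
    thus "(\<integral>\<^sup>+ z. ennreal (exp (y j)) * (\<Prod>i\<in>I. ennreal (exp (t * dict_deviation \<eta> j (z i)))) \<partial>(PiM I (\<lambda>_. P)))
      = ennreal (exp (y j)) * (\<integral>\<^sup>+ z. ennreal (exp (t * dict_deviation \<eta> j z)) \<partial>P) ^ card I"
      using nn_integral_cmult[OF m[OF j], of "ennreal (exp (y j))"] by simp
  qed
  also have "\<dots> \<le> (\<Sum>j=1..M. ennreal (exp (y j))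
      * ennreal (exp (t\<^sup>2 * L\<^sup>2 * (dict_dist \<eta> j + agg_var \<eta>) / (2 * (1 - 2 * t * L * b)))) ^ card I)"
    by (intro sum_mono mult_left_mono power_mono nn_integral_exp_dict_deviation_le \<eta> t) auto
  also have "\<dots> = (\<Sum>j=1..M. ennreal (exp (y j + real (card I) * (t\<^sup>2 * L\<^sup>2 * (dict_dist \<eta> j + agg_var \<eta>) / (2 * (1 - 2 * t * L * b))))))"
    unfolding ennreal_exp_mult_power ..
  finally show ?thesis .
qed

end

section \<open>The oracle inequality\<close>

lemma (in prob_space) exp_moment_le_one:
  fixes X :: "'a \<Rightarrow> real"
  assumes X: "integrable M X" and le: "(\<integral>\<^sup>+ \<omega>. ennreal (exp (X \<omega>)) \<partial>M) \<le> 1"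
  shows "expectation X \<le> 0" and "1 - exp (- x) \<le> prob {\<omega> \<in> space M. X \<omega> \<le> x}"
proof -
  have [measurable]: "X \<in> borel_measurable M" using X by simp
  have fin: "(\<integral>\<^sup>+ \<omega>. ennreal (exp (X \<omega>)) \<partial>M) < \<infinity>" using le by (simp add: order_le_less_trans)
  have int: "integrable M (\<lambda>\<omega>. exp (X \<omega>))" by (rule integrableI_nonneg) (use fin in auto)
  have E: "expectation (\<lambda>\<omega>. exp (X \<omega>)) \<le> 1"
    using le int by (simp add: nn_integral_eq_integral)
  have "expectation (\<lambda>\<omega>. 1 + X \<omega>) \<le> expectation (\<lambda>\<omega>. exp (X \<omega>))"
    using int X by (intro integral_mono) (auto simp: exp_ge_add_one_self)
  with E show "expectation X \<le> 0" using X by (simp add: prob_space)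
  have "prob {\<omega> \<in> space M. exp (X \<omega>) \<ge> exp x} \<le> expectation (\<lambda>\<omega>. exp (X \<omega>)) / exp x"
    by (rule integral_Markov_inequality_measure[where A = "space M", OF int]) auto
  also have "\<dots> \<le> 1 / exp x" using E by (intro divide_right_mono) auto
  finally have "prob {\<omega> \<in> space M. x \<le> X \<omega>} \<le> exp (- x)" by (simp add: exp_minus field_simps)
  moreover have "1 = prob {\<omega> \<in> space M. X \<omega> \<le> x} + prob {\<omega> \<in> space M. \<not> X \<omega> \<le> x}"
    by (subst prob_neg) auto
  moreover have "prob {\<omega> \<in> space M. \<not> X \<omega> \<le> x} \<le> prob {\<omega> \<in> space M. x \<le> X \<omega>}"
    by (intro finite_measure_mono) auto
  ultimately show "1 - exp (- x) \<le> prob {\<omega> \<in> space M. X \<omega> \<le> x}" by linarith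
qed

context dictionary
begin

lemma agg_risk_measurable:
  assumes [measurable]: "\<And>j. j \<in> {1..M} \<Longrightarrow> (\<lambda>\<omega>. \<theta> \<omega> j) \<in> borel_measurable \<Omega>"
  shows "(\<lambda>\<omega>. agg_risk (\<theta> \<omega>)) \<in> borel_measurable \<Omega>"
proof -
  have "(\<lambda>p. (snd p, agg (\<theta> (fst p)) (snd p))) \<in> measurable (\<Omega> \<Otimes>\<^sub>M P) (P \<Otimes>\<^sub>M borel)"
    unfolding f_agg_def by measurable
  from measurable_compose[OF this G_meas]
  have "(\<lambda>(\<omega>, z). G z (agg (\<theta> \<omega>) z)) \<in> borel_measurable (\<Omega> \<Otimes>\<^sub>M P)"
    by (simp add: case_prod_beta)
  thus ?thesis unfolding agg_risk_def by (rule borel_measurable_lebesgue_integral)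
qed

text \<open>Two weight vectors are at distance at most 2 in the sum norm. The bound makes the risk
  of the random weights integrable, so its expectation is a genuine integral.\<close>

lemma agg_risk_bounded:
  assumes "\<theta> \<in> \<Theta>"
  shows "\<bar>agg_risk \<theta>\<bar> \<le> \<bar>dict_risk 1\<bar> + 2 * L * b"
proof -
  have 1: "1 \<in> {1..M}" using M_pos by auto
  define e :: "nat \<Rightarrow> real" where "e = indicator {1}"
  have e: "e \<in> \<Theta>" unfolding e_def by (rule weight_simplex_vertex[OF 1])
  have "\<bar>agg_risk \<theta> - dict_risk 1\<bar> \<le> L * b * (\<Sum>j=1..M. \<bar>\<theta> j - e j\<bar>)"
    using agg_risk_Lipschitz[OF assms e] unfolding e_def agg_risk_vertex[OF 1] .
  also have "(\<Sum>j=1..M. \<bar>\<theta> j - e j\<bar>) \<le> (\<Sum>j=1..M. \<theta> j + e j)"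
    using assms e by (intro sum_mono) (auto simp: weight_simplex_def abs_if)
  also have "\<dots> = 2" using assms e by (simp add: sum.distrib weight_simplex_def)
  finally have "\<bar>agg_risk \<theta> - dict_risk 1\<bar> \<le> L * b * 2"
    using L_pos b_pos by (simp add: mult_left_mono)
  thus ?thesis by simp
qed

text \<open>The index \<open>k\<close> is arbitrary because the reference value lies below every
  penalized dictionary risk. The prior penalty is folded into the linear coefficients, so
  \<open>obj\<close> has the shape of \<open>pen_risk\<close>.\<close>

lemma exp_moment_excess_risk:
  fixes \<Omega> :: "'w measure" and D :: "nat \<Rightarrow> 'w \<Rightarrow> 'z" and \<theta>h :: "'w \<Rightarrow> nat \<Rightarrow> real"
    and \<mu> \<nu> \<beta> :: real and \<pi> :: "nat \<Rightarrow> real" and n :: nat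
  defines "\<kappa> \<equiv> \<lambda>j. \<beta> / real n * ln (1 / \<pi> j)"
  defines "obj \<equiv> \<lambda>\<omega> \<theta>. (1 - \<nu>) * (1 / real n * (\<Sum>i=1..n. G (D i \<omega>) (agg \<theta> (D i \<omega>))))
      + (\<Sum>j=1..M. \<theta> j * (\<nu> * (1 / real n * (\<Sum>i=1..n. G (D i \<omega>) (F j (D i \<omega>)))) + \<kappa> j))"
  assumes n: "0 < n" and \<nu>: "0 < \<nu>" "\<nu> < 1"
    and \<mu>: "0 < \<mu>" "10 * \<mu> \<le> \<nu> * C" "10 * \<mu> \<le> (1 - \<nu>) * C"
    and \<beta>1: "12 * L\<^sup>2 * (1 - \<nu>)\<^sup>2 \<le> \<mu> * \<beta>"
    and \<beta>2: "3 * L * \<nu> * (\<nu> * L + 4 * \<mu> * b) \<le> 2 * \<mu> * \<beta>"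
    and \<pi>: "\<And>j. j \<in> {1..M} \<Longrightarrow> 0 < \<pi> j" "(\<Sum>j=1..M. \<pi> j) = 1"
    and D: "\<And>i. i \<in> {1..n} \<Longrightarrow> D i \<in> measurable \<Omega> P"
    and D_marginal: "\<And>i. i \<in> {1..n} \<Longrightarrow> distr \<Omega> P (D i) = P"
    and D_joint: "distr \<Omega> (PiM {1..n} (\<lambda>_. P)) (\<lambda>\<omega>. \<lambda>i\<in>{1..n}. D i \<omega>) = PiM {1..n} (\<lambda>_. P)"
    and \<theta>h: "\<And>\<omega>. \<omega> \<in> space \<Omega> \<Longrightarrow> \<theta>h \<omega> \<in> \<Theta>"
    and minimal: "\<And>\<omega> \<theta>. \<omega> \<in> space \<Omega> \<Longrightarrow> \<theta> \<in> \<Theta> \<Longrightarrow> obj \<omega> (\<theta>h \<omega>) \<le> obj \<omega> \<theta>"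
    and k: "k \<in> {1..M}"
  shows "(\<integral>\<^sup>+ \<omega>. ennreal (exp (real n / \<beta> * (agg_risk (\<theta>h \<omega>) - (dict_risk k + \<kappa> k)))) \<partial>\<Omega>) \<le> 1"
proof -
  obtain \<eta> where \<eta>: "\<eta> \<in> \<Theta>"
    and ref: "\<And>j. j \<in> {1..M} \<Longrightarrow> pen_risk \<nu> \<kappa> \<eta> + \<mu> * agg_var \<eta> \<le> dict_risk j + \<kappa> j"
    and growth: "\<And>\<theta>. \<theta> \<in> \<Theta> \<Longrightarrow>
      pen_risk \<nu> \<kappa> \<eta> + \<mu> * agg_var \<eta> + 4 * \<mu> * agg_dist \<theta> \<eta> \<le> pen_risk \<nu> \<kappa> \<theta> + \<mu> * agg_var \<theta>"
    using ex_reference_weights[OF \<nu> \<mu>(1,3)] by blast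
  let ?I = "{1..n}"
  \<comment> \<open>This keeps the Bernstein denominator positive. The surplus
    \<open>3 * (L * \<nu>)\<^sup>2\<close> in \<open>\<beta>2\<close> makes it strict.\<close>
  have \<beta>6: "6 * \<nu> * L * b < \<beta>"
  proof -
    have "\<mu> * (6 * \<nu> * L * b) < \<mu> * \<beta>"
    proof -
      have "2 * (\<mu> * (6 * \<nu> * L * b)) + 3 * ((L * \<nu>) * (L * \<nu>)) \<le> 2 * (\<mu> * \<beta>)"
        using \<beta>2 by (simp add: algebra_simps)
      moreover have "0 < (L * \<nu>) * (L * \<nu>)" using \<nu> L_pos by simp
      ultimately show ?thesis by linarith
    qed
    thus ?thesis using \<mu>(1) by simp
  qed
  hence \<beta>: "0 < \<beta>" using \<nu> L_pos b_pos by (smt (verit) mult_pos_pos)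
  \<comment> \<open>Ten times \<open>\<beta>1\<close> bounds
    \<open>120 * L\<^sup>2 * (1 - \<nu>)\<^sup>2\<close> by
    \<open>(1 - \<nu>) * C * \<beta>\<close>, and \<open>L_lower\<close> trades one factor
    \<open>L\<close> for \<open>C * b / 2\<close>. With the \<open>c\<close> below this gives
    \<open>4 * c * L * b \<le> 84/300 = 7/25\<close>.\<close>
  have \<beta>60: "60 * (1 - \<nu>) * L * b \<le> \<beta>"
  proof -
    have "(1 - \<nu>) * L * (60 * (1 - \<nu>)) * (C * b) \<le> (1 - \<nu>) * L * (60 * (1 - \<nu>)) * (2 * L)"
      using L_lower \<nu> L_pos by (intro mult_left_mono) auto
    also have "\<dots> = 10 * (12 * L\<^sup>2 * (1 - \<nu>)\<^sup>2)" by (simp add: power2_eq_square)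
    also have "\<dots> \<le> (10 * \<mu>) * \<beta>" using \<beta>1 unfolding mult.assoc by linarith
    also have "\<dots> \<le> ((1 - \<nu>) * C) * \<beta>" using \<mu>(3) \<beta> by (intro mult_right_mono) auto
    finally have "((1 - \<nu>) * C) * (60 * (1 - \<nu>) * L * b) \<le> ((1 - \<nu>) * C) * \<beta>" by (simp add: mult_ac)
    thus ?thesis using \<nu> C_pos by simp
  qed
  \<comment> \<open>The excess risk carries the factor 7/4. Division by the convexity weights 5/12
    and 7/12 gives 21/5 here and 3 in \<open>t\<close>.\<close>
  define c where "c = 21/5 * (1 - \<nu>) / \<beta>"
  define t where "t = 3 * \<nu> / \<beta>"
  define V where "V = agg_var \<eta>"
  \<comment> \<open>The offsets prepay the variance terms: after integration every exponent is at
    most \<open>ln (\<pi> j)\<close>, and the exponentials sum to at most 1.\<close>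
  define y1 where "y1 j = ln (\<pi> j) - real n * (3 * \<mu> / \<beta> * dict_dist \<eta> j)" for j
  define y2 where "y2 j = ln (\<pi> j) - real n * (3 * \<mu> / \<beta> * (dict_dist \<eta> j + V))" for j
  have c: "0 \<le> c" "4 * c * L * b \<le> 7/25"
    using \<beta> \<beta>60 \<nu> by (simp_all add: c_def field_simps)
  have t: "0 \<le> t" "2 * t * L * b < 1"
    using \<beta> \<beta>6 \<nu> by (simp_all add: t_def field_simps)
  have V: "0 \<le> V" unfolding V_def by (rule agg_var_nonneg[OF \<eta>])
  \<comment> \<open>The product \<open>51/25 * (21/5)\<^sup>2\<close> is 35.9856, just below 36,
    which is three times the constant 12 in \<open>\<beta>1\<close>.\<close>
  have rate1: "51/25 * c\<^sup>2 * L\<^sup>2 \<le> 3 * \<mu> / \<beta>"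
  proof -
    have "51/25 * c\<^sup>2 * L\<^sup>2 * \<beta>\<^sup>2 = 51/25 * (21/5)\<^sup>2 * (L\<^sup>2 * (1 - \<nu>)\<^sup>2)"
    proof -
      have "c * \<beta> = 21/5 * (1 - \<nu>)" using \<beta> by (simp add: c_def)
      hence "(c * \<beta>)\<^sup>2 = (21/5)\<^sup>2 * (1 - \<nu>)\<^sup>2" by (simp only: power_mult_distrib)
      hence "51/25 * L\<^sup>2 * (c\<^sup>2 * \<beta>\<^sup>2) = 51/25 * L\<^sup>2 * ((21/5)\<^sup>2 * (1 - \<nu>)\<^sup>2)"
        by (simp only: power_mult_distrib)
      thus ?thesis by (simp only: mult_ac)
    qed
    also have "\<dots> \<le> 36 * (L\<^sup>2 * (1 - \<nu>)\<^sup>2)" by (intro mult_right_mono) (auto simp: power2_eq_square)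
    also have "\<dots> \<le> 3 * \<mu> * \<beta>" using \<beta>1 unfolding mult.assoc by linarith
    also have "\<dots> = 3 * \<mu> / \<beta> * \<beta>\<^sup>2" using \<beta> by (simp add: power2_eq_square)
    finally show ?thesis by (rule mult_right_le_imp_le) (use \<beta> in simp)
  qed
  \<comment> \<open>After clearing denominators this is precisely \<open>\<beta>2\<close>.\<close>
  have rate2: "t\<^sup>2 * L\<^sup>2 / (2 * (1 - 2 * t * L * b)) \<le> 3 * \<mu> / \<beta>"
  proof -
    have "t\<^sup>2 * L\<^sup>2 * \<beta>\<^sup>2 = 3 * (3 * \<nu>\<^sup>2 * L\<^sup>2)" using \<beta> by (simp add: t_def power_divide power_mult_distrib)
    also have "\<dots> \<le> 3 * (2 * \<mu> * (\<beta> - 6 * \<nu> * L * b))" using \<beta>2 by (simp add: power2_eq_square algebra_simps)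
    also have "\<dots> = 3 * \<mu> / \<beta> * (2 * (1 - 2 * t * L * b)) * \<beta>\<^sup>2"
      using \<beta> by (simp add: t_def power2_eq_square field_simps)
    finally have "t\<^sup>2 * L\<^sup>2 \<le> 3 * \<mu> / \<beta> * (2 * (1 - 2 * t * L * b))"
      by (rule mult_right_le_imp_le) (use \<beta> in simp)
    moreover have "0 < 2 * (1 - 2 * t * L * b)"
      using t(2) by (intro mult_pos_pos) (simp_all only: diff_gt_0_iff_gt zero_less_numeral)
    ultimately show ?thesis by (simp only: pos_divide_le_eq)
  qed
  have sum_\<pi>: "(\<Sum>j=1..M. ennreal (exp (y j))) \<le> 1"
    if "\<And>j. j \<in> {1..M} \<Longrightarrow> y j \<le> ln (\<pi> j)" for y
  proof -
    have "(\<Sum>j=1..M. exp (y j)) \<le> (\<Sum>j=1..M. \<pi> j)"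
      using that \<pi>(1) by (intro sum_mono) (metis exp_le_cancel_iff exp_ln)
    thus ?thesis using \<pi>(2) by (simp add: ennreal_le_1)
  qed
  have process1: "(\<integral>\<^sup>+ z. agg_process \<eta> c y1 ?I z \<partial>(PiM ?I (\<lambda>_. P))) \<le> 1"
  proof (rule order_trans[OF nn_integral_agg_process_le[OF \<eta> c] sum_\<pi>])
    fix j
    have "51/25 * c\<^sup>2 * L\<^sup>2 * dict_dist \<eta> j \<le> 3 * \<mu> / \<beta> * dict_dist \<eta> j"
      by (rule mult_right_mono[OF rate1 dict_dist_nonneg])
    from mult_left_mono[OF this, of "real n"]
    show "y1 j + real (card ?I) * (51/25 * c\<^sup>2 * L\<^sup>2 * dict_dist \<eta> j) \<le> ln (\<pi> j)"
      by (simp add: y1_def)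
  qed simp
  have process2: "(\<integral>\<^sup>+ z. dict_process \<eta> t y2 ?I z \<partial>(PiM ?I (\<lambda>_. P))) \<le> 1"
  proof (rule order_trans[OF nn_integral_dict_process_le[OF \<eta> t] sum_\<pi>])
    fix j
    have "t\<^sup>2 * L\<^sup>2 / (2 * (1 - 2 * t * L * b)) * (dict_dist \<eta> j + V) \<le> 3 * \<mu> / \<beta> * (dict_dist \<eta> j + V)"
      by (rule mult_right_mono[OF rate2 add_nonneg_nonneg[OF dict_dist_nonneg V]])
    from mult_left_mono[OF this, of "real n"]
    show "y2 j + real (card ?I) * (t\<^sup>2 * L\<^sup>2 * (dict_dist \<eta> j + agg_var \<eta>) / (2 * (1 - 2 * t * L * b))) \<le> ln (\<pi> j)"
      by (simp add: y2_def V_def)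
  qed simp
  define Z where "Z \<omega> = (\<lambda>i\<in>?I. D i \<omega>)" for \<omega>
  have Z: "Z \<in> measurable \<Omega> (PiM ?I (\<lambda>_. P))"
    unfolding Z_def[abs_def] using D by (intro measurable_restrict) auto
  have Z_distr: "distr \<Omega> (PiM ?I (\<lambda>_. P)) Z = PiM ?I (\<lambda>_. P)"
    unfolding Z_def[abs_def] by (rule D_joint)
  have transfer: "(\<integral>\<^sup>+ \<omega>. \<phi> (Z \<omega>) \<partial>\<Omega>) = (\<integral>\<^sup>+ z. \<phi> z \<partial>(PiM ?I (\<lambda>_. P)))"
    if "\<phi> \<in> borel_measurable (PiM ?I (\<lambda>_. P))" for \<phi>
    using nn_integral_distr[OF Z, of \<phi>] that unfolding Z_distr by simp
  have good_D: "AE \<omega> in \<Omega>. \<forall>i\<in>?I. good (D i \<omega>)"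
  proof (subst AE_finite_all, simp, intro ballI)
    fix i assume i: "i \<in> ?I"
    have "AE z in distr \<Omega> P (D i). good z" unfolding D_marginal[OF i] by (rule AE_good)
    thus "AE \<omega> in \<Omega>. good (D i \<omega>)" by (rule AE_distrD[OF D[OF i]])
  qed
  have excess: "real n / \<beta> * (agg_risk \<theta> - (dict_risk k + \<kappa> k))
      \<le> 5/12 * ((\<Sum>j=1..M. \<theta> j * y1 j) + c * (\<Sum>i\<in>?I. agg_deviation \<eta> \<theta> (D i \<omega>)))
      + 7/12 * ((\<Sum>j=1..M. \<theta> j * y2 j) + t * (\<Sum>i\<in>?I. \<Sum>j=1..M. \<theta> j * dict_deviation \<eta> j (D i \<omega>)))"
    if \<omega>: "\<omega> \<in> space \<Omega>" and \<theta>_def: "\<theta> = \<theta>h \<omega>" for \<omega> \<theta>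
  proof -
    have \<theta>: "\<theta> \<in> \<Theta>" unfolding \<theta>_def by (rule \<theta>h[OF \<omega>])
    have s: "(\<Sum>j=1..M. \<theta> j) = 1" using \<theta> by (simp add: weight_simplex_def)
    define rn where "rn \<theta> = 1 / real n * (\<Sum>i=1..n. G (D i \<omega>) (agg \<theta> (D i \<omega>)))" for \<theta>
    define dn where "dn j = 1 / real n * (\<Sum>i=1..n. G (D i \<omega>) (F j (D i \<omega>)))" for j
    define S1 where "S1 = (\<Sum>i\<in>?I. agg_deviation \<eta> \<theta> (D i \<omega>))"
    define S2 where "S2 = (\<Sum>i\<in>?I. \<Sum>j=1..M. \<theta> j * dict_deviation \<eta> j (D i \<omega>))"
    define K where "K = (\<Sum>j=1..M. \<theta> j * ln (\<pi> j))"
    define DD where "DD = (\<Sum>j=1..M. \<theta> j * dict_dist \<eta> j)"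
    have obj: "obj \<omega> \<zeta> = (1 - \<nu>) * rn \<zeta> + \<nu> * (\<Sum>j=1..M. \<zeta> j * dn j) + (\<Sum>j=1..M. \<zeta> j * \<kappa> j)" for \<zeta>
      by (simp add: obj_def rn_def dn_def algebra_simps sum.distrib sum_distrib_left)
    have pen: "pen_risk \<nu> \<kappa> \<zeta>
      = (1 - \<nu>) * agg_risk \<zeta> + \<nu> * (\<Sum>j=1..M. \<zeta> j * dict_risk j) + (\<Sum>j=1..M. \<zeta> j * \<kappa> j)" for \<zeta>
      by (simp add: pen_risk_def algebra_simps sum.distrib sum_distrib_left)
    have S1: "S1 = real n * ((agg_risk \<theta> - agg_risk \<eta>) - (rn \<theta> - rn \<eta>))"
      using n by (simp add: S1_def agg_deviation_def rn_def sum_subtractf sum.distrib right_diff_distrib)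
    have S2: "S2 = real n * (((\<Sum>j=1..M. \<theta> j * dict_risk j) - (\<Sum>j=1..M. \<eta> j * dict_risk j))
         - ((\<Sum>j=1..M. \<theta> j * dn j) - (\<Sum>j=1..M. \<eta> j * dn j)))"
    proof -
      have mean: "(\<Sum>j=1..M. \<zeta> j * dn j) = 1 / real n * (\<Sum>i=1..n. \<Sum>j=1..M. \<zeta> j * G (D i \<omega>) (F j (D i \<omega>)))" for \<zeta>
        unfolding dn_def by (subst sum.swap) (simp add: sum_distrib_left mult_ac)
      have "(\<Sum>j=1..M. \<theta> j * dict_deviation \<eta> j z)
        = ((\<Sum>j=1..M. \<theta> j * dict_risk j) - (\<Sum>j=1..M. \<eta> j * dict_risk j))
         - ((\<Sum>j=1..M. \<theta> j * G z (F j z)) - (\<Sum>j=1..M. \<eta> j * G z (F j z)))" for z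
        unfolding dict_deviation_def right_diff_distrib sum_subtractf
        using s by (simp flip: sum_distrib_right)
      thus ?thesis using n unfolding S2_def mean by (simp add: sum_subtractf right_diff_distrib)
    qed
    \<comment> \<open>Minimality makes the empirical objective at \<open>\<theta>\<close> at most
      that at \<open>\<eta>\<close>. The penalties cancel in the deviations, so the population
      difference is at most the sum of the two centred fluctuations.\<close>
    have A: "pen_risk \<nu> \<kappa> \<theta> - pen_risk \<nu> \<kappa> \<eta> \<le> (1 - \<nu>) * (S1 / real n) + \<nu> * (S2 / real n)"
    proof -
      have s1: "S1 / real n = (agg_risk \<theta> - agg_risk \<eta>) - (rn \<theta> - rn \<eta>)"
        and s2: "S2 / real n = ((\<Sum>j=1..M. \<theta> j * dict_risk j) - (\<Sum>j=1..M. \<eta> j * dict_risk j))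
         - ((\<Sum>j=1..M. \<theta> j * dn j) - (\<Sum>j=1..M. \<eta> j * dn j))"
        unfolding S1 S2 using n by simp_all
      show ?thesis using minimal[OF \<omega> \<eta>] unfolding \<theta>_def[symmetric] obj pen s1 s2
        by (simp add: algebra_simps)
    qed
    have "agg_risk \<theta> - (dict_risk k + \<kappa> k) \<le> 7/4 * ((1 - \<nu>) * (S1 / real n) + \<nu> * (S2 / real n))
       - 3 * \<mu> * DD - 7/4 * \<mu> * V - (\<Sum>j=1..M. \<theta> j * \<kappa> j)"
      unfolding DD_def V_def
      by (rule excess_risk_le_fluctuation[OF \<mu>(2) \<theta> \<eta> ref[OF k] growth[OF \<theta>] A \<mu>(1) \<nu>(1)])
    also have "(\<Sum>j=1..M. \<theta> j * \<kappa> j) = - (\<beta> / real n) * K"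
    proof -
      have "\<theta> j * \<kappa> j = - (\<beta> / real n) * (\<theta> j * ln (\<pi> j))" if "j \<in> {1..M}" for j
        using \<pi>(1)[OF that] by (simp add: \<kappa>_def ln_div)
      thus ?thesis unfolding K_def sum_distrib_left by (intro sum.cong) auto
    qed
    finally have "real n / \<beta> * (agg_risk \<theta> - (dict_risk k + \<kappa> k))
      \<le> real n / \<beta> * (7/4 * ((1 - \<nu>) * (S1 / real n) + \<nu> * (S2 / real n))
       - 3 * \<mu> * DD - 7/4 * \<mu> * V - - (\<beta> / real n) * K)"
      using \<beta> by (intro mult_left_mono) auto
    also have "\<dots> = 5/12 * ((K - real n * (3 * \<mu> / \<beta> * DD)) + c * S1)
       + 7/12 * ((K - real n * (3 * \<mu> / \<beta> * (DD + V))) + t * S2)"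
      using \<beta> n by (simp add: c_def t_def field_simps)
    also have "K - real n * (3 * \<mu> / \<beta> * DD) = (\<Sum>j=1..M. \<theta> j * y1 j)"
      by (simp add: K_def DD_def y1_def right_diff_distrib sum_subtractf sum_distrib_left mult_ac)
    also have "K - real n * (3 * \<mu> / \<beta> * (DD + V)) = (\<Sum>j=1..M. \<theta> j * y2 j)"
    proof -
      have "(\<Sum>j=1..M. \<theta> j * y2 j) = (\<Sum>j=1..M. \<theta> j * ln (\<pi> j) - real n * (3 * \<mu> / \<beta>) * (\<theta> j * dict_dist \<eta> j) - \<theta> j * (real n * (3 * \<mu> / \<beta>) * V))"
        by (intro sum.cong refl) (simp add: y2_def algebra_simps)
      also have "\<dots> = K - real n * (3 * \<mu> / \<beta>) * DD - (\<Sum>j=1..M. \<theta> j) * (real n * (3 * \<mu> / \<beta>) * V)"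
        by (simp only: sum_subtractf K_def DD_def sum_distrib_left sum_distrib_right)
      finally show ?thesis using s by (simp add: algebra_simps add_divide_distrib)
    qed
    finally show ?thesis unfolding S1_def S2_def .
  qed
  have "(\<integral>\<^sup>+ \<omega>. ennreal (exp (real n / \<beta> * (agg_risk (\<theta>h \<omega>) - (dict_risk k + \<kappa> k)))) \<partial>\<Omega>)
     \<le> (\<integral>\<^sup>+ \<omega>. ennreal (5/12) * agg_process \<eta> c y1 ?I (Z \<omega>) + ennreal (7/12) * dict_process \<eta> t y2 ?I (Z \<omega>) \<partial>\<Omega>)"
  proof (rule nn_integral_mono_AE)
    show "AE \<omega> in \<Omega>. ennreal (exp (real n / \<beta> * (agg_risk (\<theta>h \<omega>) - (dict_risk k + \<kappa> k))))
      \<le> ennreal (5/12) * agg_process \<eta> c y1 ?I (Z \<omega>) + ennreal (7/12) * dict_process \<eta> t y2 ?I (Z \<omega>)"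
      using good_D AE_space
    proof eventually_elim
      case (elim \<omega>)
      define W1 where "W1 = (\<Sum>j=1..M. \<theta>h \<omega> j * y1 j) + c * (\<Sum>i\<in>?I. agg_deviation \<eta> (\<theta>h \<omega>) (Z \<omega> i))"
      define W2 where "W2 = (\<Sum>j=1..M. \<theta>h \<omega> j * y2 j)
        + t * (\<Sum>i\<in>?I. \<Sum>j=1..M. \<theta>h \<omega> j * dict_deviation \<eta> j (Z \<omega> i))"
      have "real n / \<beta> * (agg_risk (\<theta>h \<omega>) - (dict_risk k + \<kappa> k)) \<le> 5/12 * W1 + 7/12 * W2"
        using excess[OF elim(2) refl] by (simp add: W1_def W2_def Z_def)
      hence "exp (real n / \<beta> * (agg_risk (\<theta>h \<omega>) - (dict_risk k + \<kappa> k))) \<le> exp (5/12 * W1 + 7/12 * W2)"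
        by simp
      also have "\<dots> \<le> 5/12 * exp W1 + 7/12 * exp W2"
        using convex_onD[OF exp_convex, of "7/12" W1 W2] by simp
      finally have "ennreal (exp (real n / \<beta> * (agg_risk (\<theta>h \<omega>) - (dict_risk k + \<kappa> k))))
         \<le> ennreal (5/12) * ennreal (exp W1) + ennreal (7/12) * ennreal (exp W2)"
        by (simp add: ennreal_leI flip: ennreal_mult ennreal_plus)
      also have "\<dots> \<le> ennreal (5/12) * agg_process \<eta> c y1 ?I (Z \<omega>) + ennreal (7/12) * dict_process \<eta> t y2 ?I (Z \<omega>)"
        unfolding W1_def W2_def using elim
        by (intro add_mono mult_left_mono exp_le_agg_process exp_le_dict_process \<theta>h) (auto simp: Z_def)
      finally show ?case .
    qed
  qed
  also have "\<dots> = ennreal (5/12) * (\<integral>\<^sup>+ \<omega>. agg_process \<eta> c y1 ?I (Z \<omega>) \<partial>\<Omega>)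
      + ennreal (7/12) * (\<integral>\<^sup>+ \<omega>. dict_process \<eta> t y2 ?I (Z \<omega>) \<partial>\<Omega>)"
    using measurable_compose[OF Z agg_process_measurable] measurable_compose[OF Z dict_process_measurable]
    by (simp add: nn_integral_add nn_integral_cmult)
  also have "(\<integral>\<^sup>+ \<omega>. agg_process \<eta> c y1 ?I (Z \<omega>) \<partial>\<Omega>) = (\<integral>\<^sup>+ z. agg_process \<eta> c y1 ?I z \<partial>(PiM ?I (\<lambda>_. P)))"
    by (rule transfer[OF agg_process_measurable])
  also have "(\<integral>\<^sup>+ \<omega>. dict_process \<eta> t y2 ?I (Z \<omega>) \<partial>\<Omega>) = (\<integral>\<^sup>+ z. dict_process \<eta> t y2 ?I z \<partial>(PiM ?I (\<lambda>_. P)))"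
    by (rule transfer[OF dict_process_measurable])
  also have "ennreal (5/12) * (\<integral>\<^sup>+ z. agg_process \<eta> c y1 ?I z \<partial>(PiM ?I (\<lambda>_. P)))
      + ennreal (7/12) * (\<integral>\<^sup>+ z. dict_process \<eta> t y2 ?I z \<partial>(PiM ?I (\<lambda>_. P)))
     \<le> ennreal (5/12) * 1 + ennreal (7/12) * 1"
    by (intro add_mono mult_left_mono process1 process2) auto
  also have "\<dots> = 1" by (simp flip: ennreal_plus)
  finally show ?thesis .
qed

end

section \<open>Transfer to regression pairs and both conclusions\<close>

theorem theorem1:
  fixes \<Omega> :: "'a measure"
    and Mx :: "'x measure"
    and P :: "('x \<times> real) measure"
    and D :: "nat \<Rightarrow> 'a \<Rightarrow> 'x \<times> real"
    and f :: "nat \<Rightarrow> 'x \<Rightarrow> real"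
    and l :: "real \<Rightarrow> real \<Rightarrow> real"
    and n M :: nat
    and b C_b C_l \<nu> \<beta> :: real
    and \<pi> :: "nat \<Rightarrow> real"
    and \<theta>hat :: "'a \<Rightarrow> nat \<Rightarrow> real"
  assumes prob: "prob_space \<Omega>"
    and n_pos: "0 < n"
    and b_pos: "0 < b"
    and Y_bdd: "AE z in P. \<bar>snd z\<bar> \<le> b"
    and D_indep: "prob_space.indep_vars \<Omega> (\<lambda>_. Mx \<Otimes>\<^sub>M borel) D {1..n}"
    and D_distr: "\<forall>i\<in>{1..n}. distr \<Omega> (Mx \<Otimes>\<^sub>M borel) (D i) = P"
    and f_meas: "\<forall>j\<in>{1..M}. f j \<in> borel_measurable Mx"
    and f_bdd: "AE z in P. \<forall>j\<in>{1..M}. \<bar>f j (fst z)\<bar> \<le> b"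
    and l_meas: "(\<lambda>p. l (fst p) (snd p)) \<in> borel_measurable (borel \<Otimes>\<^sub>M borel)"
    and risk_int: "\<forall>j\<in>{1..M}. integrable P (\<lambda>z. l (snd z) (f j (fst z)))"
    and lipschitz: "AE z in P. \<forall>u\<in>{-b..b}. \<forall>v\<in>{-b..b}.
                      \<bar>l (snd z) u - l (snd z) v\<bar> \<le> C_b * \<bar>u - v\<bar>"
    and C_l_pos: "0 < C_l"
    and strong_conv: "AE z in P. strongly_convex_on_mod {-b..b} C_l (l (snd z))"
    and \<nu>_range: "0 < \<nu>" "\<nu> < 1"
    and \<pi>_pos: "\<forall>j\<in>{1..M}. 0 < \<pi> j"
    and \<pi>_sum: "(\<Sum>j=1..M. \<pi> j) = 1"
    and \<beta>_big: "\<beta> > Max {12 * C_b\<^sup>2 * (1 - \<nu>)\<^sup>2 / (min \<nu> (1 - \<nu>) * C_l / 10),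
                          6 * sqrt 3 * b * C_b * (1 - \<nu>),
                          3 * C_b * \<nu> * (\<nu> * C_b + 4 * (min \<nu> (1 - \<nu>) * C_l / 10) * b)
                            / (2 * (min \<nu> (1 - \<nu>) * C_l / 10))}"
    and \<theta>hat_meas: "\<forall>j. (\<lambda>\<omega>. \<theta>hat \<omega> j) \<in> borel_measurable \<Omega>"
    and \<theta>hat_simplex: "\<forall>\<omega>\<in>space \<Omega>. \<theta>hat \<omega> \<in> weight_simplex M"
    and \<theta>hat_min: "\<forall>\<omega>\<in>space \<Omega>. \<forall>\<theta>\<in>weight_simplex M.
        Q_obj l f M \<nu> \<beta> \<pi> n (\<lambda>i. D i \<omega>) (\<theta>hat \<omega>) \<le> Q_obj l f M \<nu> \<beta> \<pi> n (\<lambda>i. D i \<omega>) \<theta>"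
  shows "(\<forall>x>0. measure \<Omega> {\<omega>\<in>space \<Omega>.
              risk P l (f_agg f M (\<theta>hat \<omega>))
                \<le> Min ((\<lambda>j. risk P l (f j) + \<beta> / real n * ln (1 / \<pi> j)) ` {1..M})
                   + 2 * \<beta> * x / real n} \<ge> 1 - exp (- x))
       \<and> (\<integral>\<omega>. risk P l (f_agg f M (\<theta>hat \<omega>)) \<partial>\<Omega>)
           \<le> Min ((\<lambda>j. risk P l (f j) + \<beta> / real n * ln (1 / \<pi> j)) ` {1..M})"
proof -
  interpret \<Omega>: prob_space \<Omega> by (rule prob)
  have Max_less: "12 * C_b\<^sup>2 * (1 - \<nu>)\<^sup>2 / (min \<nu> (1 - \<nu>) * C_l / 10) < \<beta>"
    "3 * C_b * \<nu> * (\<nu> * C_b + 4 * (min \<nu> (1 - \<nu>) * C_l / 10) * b) / (2 * (min \<nu> (1 - \<nu>) * C_l / 10)) < \<beta>"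
    using \<beta>_big by simp_all
  define \<mu> where "\<mu> = min \<nu> (1 - \<nu>) * C_l / 10"
  have \<mu>: "0 < \<mu>" using \<nu>_range C_l_pos by (simp add: \<mu>_def)
  have \<mu>_le: "10 * \<mu> \<le> \<nu> * C_l" "10 * \<mu> \<le> (1 - \<nu>) * C_l"
    using C_l_pos by (auto simp: \<mu>_def intro!: mult_right_mono)
  have \<beta>1: "12 * C_b\<^sup>2 * (1 - \<nu>)\<^sup>2 \<le> \<mu> * \<beta>"
    using Max_less(1) \<mu> unfolding \<mu>_def[symmetric] by (simp add: pos_divide_less_eq mult.commute)
  have \<beta>2: "3 * C_b * \<nu> * (\<nu> * C_b + 4 * \<mu> * b) \<le> 2 * \<mu> * \<beta>"
    using Max_less(2) \<mu> unfolding \<mu>_def[symmetric] by (simp add: pos_divide_less_eq mult.commute)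
  have \<beta>_pos: "0 < \<beta>"
  proof -
    have "0 \<le> 12 * C_b\<^sup>2 * (1 - \<nu>)\<^sup>2 / \<mu>" using \<mu> by simp
    with Max_less(1) show ?thesis unfolding \<mu>_def[symmetric] by linarith
  qed
  have D_meas: "D i \<in> measurable \<Omega> (Mx \<Otimes>\<^sub>M borel)" if "i \<in> {1..n}" for i
    using D_indep that unfolding \<Omega>.indep_vars_def by (elim conjE) (rule bspec)
  have one: "1 \<in> {1..n}" using n_pos by simp
  have P: "P = distr \<Omega> (Mx \<Otimes>\<^sub>M borel) (D 1)" using bspec[OF D_distr one] by (rule sym)
  have sets_P: "sets P = sets (Mx \<Otimes>\<^sub>M borel)" by (simp add: P)
  have M_pos: "0 < M" using \<pi>_sum by (cases "M = 0") auto
  define F where "F j z = f j (fst z)" for j and z :: "'x \<times> real"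
  define G where "G z u = l (snd z) u" for z :: "'x \<times> real" and u
  have agg: "f_agg F M \<theta> z = f_agg f M \<theta> (fst z)" for \<theta> z
    by (simp add: f_agg_def F_def)
  interpret dictionary P F G M b C_b C_l
  proof (intro dictionary.intro dictionary_axioms.intro)
    show "prob_space P" unfolding P by (rule \<Omega>.prob_space_distr[OF D_meas[OF one]])
    show "F j \<in> borel_measurable P" if "j \<in> {1..M}" for j
    proof -
      have "fst \<in> measurable P Mx" unfolding measurable_cong_sets[OF sets_P refl] by (rule measurable_fst)
      from measurable_compose[OF this bspec[OF f_meas that]] show ?thesis unfolding F_def[abs_def] .
    qed
    have "snd \<in> measurable P borel" unfolding measurable_cong_sets[OF sets_P refl] by (rule measurable_snd)
    hence "(\<lambda>p. (snd (fst p), snd p)) \<in> measurable (P \<Otimes>\<^sub>M borel) (borel \<Otimes>\<^sub>M borel)"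
      by (intro measurable_Pair measurable_compose[OF measurable_fst] measurable_snd)
    from measurable_compose[OF this l_meas]
    show "(\<lambda>(z, u). G z u) \<in> borel_measurable (P \<Otimes>\<^sub>M borel)"
      by (simp add: G_def case_prod_beta)
    show "integrable P (\<lambda>z. G z (F j z))" if "j \<in> {1..M}" for j
      using risk_int that by (simp add: G_def F_def)
    show "AE z in P. \<forall>j\<in>{1..M}. \<bar>F j z\<bar> \<le> b" using f_bdd by (simp add: F_def)
    show "AE z in P. \<forall>u\<in>{-b..b}. \<forall>v\<in>{-b..b}. \<bar>G z u - G z v\<bar> \<le> C_b * \<bar>u - v\<bar>"
      using lipschitz by (simp add: G_def)
    show "AE z in P. strongly_convex_on_mod {-b..b} C_l (G z)"
      using strong_conv by (simp add: G_def[abs_def])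
  qed (fact M_pos b_pos C_l_pos)+
  have agg_risk: "agg_risk \<theta> = risk P l (f_agg f M \<theta>)" for \<theta>
    by (simp add: agg_risk_def risk_def G_def agg)
  have dict_risk: "dict_risk j = risk P l (f j)" for j
    by (simp add: dict_risk_def risk_def G_def F_def)
  have D_joint: "distr \<Omega> (PiM {1..n} (\<lambda>_. P)) (\<lambda>\<omega>. \<lambda>i\<in>{1..n}. D i \<omega>) = PiM {1..n} (\<lambda>_. P)"
  proof -
    have "distr \<Omega> (PiM {1..n} (\<lambda>_. Mx \<Otimes>\<^sub>M borel)) (\<lambda>\<omega>. \<lambda>i\<in>{1..n}. D i \<omega>)
      = PiM {1..n} (\<lambda>i. distr \<Omega> (Mx \<Otimes>\<^sub>M borel) (D i))"
      using D_indep one by (subst (asm) \<Omega>.indep_vars_iff_distr_eq_PiM') (auto intro: D_meas)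
    also have "\<dots> = PiM {1..n} (\<lambda>_. P)" using D_distr by (intro PiM_cong) auto
    also have "distr \<Omega> (PiM {1..n} (\<lambda>_. Mx \<Otimes>\<^sub>M borel)) (\<lambda>\<omega>. \<lambda>i\<in>{1..n}. D i \<omega>)
      = distr \<Omega> (PiM {1..n} (\<lambda>_. P)) (\<lambda>\<omega>. \<lambda>i\<in>{1..n}. D i \<omega>)"
      by (intro distr_cong sets_PiM_cong refl) (simp_all add: sets_P)
    finally show ?thesis .
  qed
  have Q: "Q_obj l f M \<nu> \<beta> \<pi> n (\<lambda>i. D i \<omega>) \<theta>
    = (1 - \<nu>) * (1 / real n * (\<Sum>i=1..n. G (D i \<omega>) (agg \<theta> (D i \<omega>))))
      + (\<Sum>j=1..M. \<theta> j * (\<nu> * (1 / real n * (\<Sum>i=1..n. G (D i \<omega>) (F j (D i \<omega>)))) + \<beta> / real n * ln (1 / \<pi> j)))"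
    for \<omega> \<theta>
  proof -
    define e where "e j = 1 / real n * (\<Sum>i=1..n. G (D i \<omega>) (F j (D i \<omega>)))" for j
    have "(\<Sum>j=1..M. \<theta> j * (\<nu> * e j + \<beta> / real n * ln (1 / \<pi> j)))
      = (\<Sum>j=1..M. \<nu> * (\<theta> j * e j) - \<beta> / real n * (\<theta> j * ln (\<pi> j)))"
      using \<pi>_pos by (intro sum.cong refl) (simp add: ln_div algebra_simps)
    also have "\<dots> = \<nu> * (\<Sum>j=1..M. \<theta> j * e j) - \<beta> / real n * (\<Sum>j=1..M. \<theta> j * ln (\<pi> j))"
      by (simp only: sum_subtractf sum_distrib_left)
    finally show ?thesis
      unfolding Q_obj_def emp_risk_def e_def agg by (simp add: G_def F_def)
  qed
  let ?R = "\<lambda>\<omega>. risk P l (f_agg f M (\<theta>hat \<omega>))"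
  let ?m = "Min ((\<lambda>j. risk P l (f j) + \<beta> / real n * ln (1 / \<pi> j)) ` {1..M})"
  \<comment> \<open>An index attaining the minimum is fixed, so a single exponential moment bound
    serves both conclusions.\<close>
  have "?m \<in> (\<lambda>j. risk P l (f j) + \<beta> / real n * ln (1 / \<pi> j)) ` {1..M}"
    using M_pos by (intro Min_in) auto
  then obtain k where k: "k \<in> {1..M}" "?m = risk P l (f k) + \<beta> / real n * ln (1 / \<pi> k)" by blast
  define X where "X \<omega> = real n / \<beta> * (?R \<omega> - ?m)" for \<omega>
  have "(\<integral>\<^sup>+ \<omega>. ennreal (exp (real n / \<beta> * (agg_risk (\<theta>hat \<omega>) - (dict_risk k + \<beta> / real n * ln (1 / \<pi> k))))) \<partial>\<Omega>) \<le> 1"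
  proof (rule exp_moment_excess_risk[OF n_pos \<nu>_range \<mu> \<mu>_le \<beta>1 \<beta>2 _ \<pi>_sum _ _ D_joint _ _ k(1)])
    show "D i \<in> measurable \<Omega> P" if "i \<in> {1..n}" for i
      using D_meas[OF that] by (simp add: measurable_cong_sets[OF refl sets_P])
    show "distr \<Omega> P (D i) = P" if "i \<in> {1..n}" for i
    proof -
      have "distr \<Omega> P (D i) = distr \<Omega> (Mx \<Otimes>\<^sub>M borel) (D i)" by (intro distr_cong refl sets_P)
      thus ?thesis using D_distr that by simp
    qed
    show "0 < \<pi> j" if "j \<in> {1..M}" for j using \<pi>_pos that by blast
    show "\<theta>hat \<omega> \<in> \<Theta>" if "\<omega> \<in> space \<Omega>" for \<omega> using \<theta>hat_simplex that by blast
  qed (use \<theta>hat_min in \<open>unfold Q, blast\<close>)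
  hence moment: "(\<integral>\<^sup>+ \<omega>. ennreal (exp (X \<omega>)) \<partial>\<Omega>) \<le> 1"
    unfolding X_def k(2) agg_risk dict_risk .
  have R_int: "integrable \<Omega> ?R"
  proof (rule \<Omega>.integrable_const_bound)
    show "AE \<omega> in \<Omega>. norm (?R \<omega>) \<le> \<bar>dict_risk 1\<bar> + 2 * C_b * b"
      using \<theta>hat_simplex agg_risk_bounded by (intro AE_I2) (simp add: agg_risk)
    show "?R \<in> borel_measurable \<Omega>"
      using agg_risk_measurable[of \<theta>hat \<Omega>] \<theta>hat_meas by (simp add: agg_risk)
  qed
  hence X_int: "integrable \<Omega> X" unfolding X_def[abs_def] by (intro integrable_mult_right Bochner_Integration.integrable_diff) auto
  note tail = \<Omega>.exp_moment_le_one[OF X_int moment]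
  show ?thesis
  proof (intro conjI allI impI)
    fix x :: real assume x: "0 < x"
    have X_le: "X \<omega> \<le> 2 * x \<longleftrightarrow> ?R \<omega> \<le> ?m + 2 * \<beta> * x / real n" for \<omega>
      using \<beta>_pos n_pos by (simp add: X_def field_simps)
    \<comment> \<open>The remainder \<open>2 * \<beta> * x / n\<close> corresponds to the level
      \<open>2 * x\<close> for \<open>X\<close>, where Markov's inequality gives a failure
      probability of at most \<open>exp (- (2 * x))\<close>.\<close>
    have "exp (- (2 * x)) \<le> exp (- x)" using x by simp
    thus "1 - exp (- x) \<le> measure \<Omega> {\<omega> \<in> space \<Omega>. ?R \<omega> \<le> ?m + 2 * \<beta> * x / real n}"
      using tail(2)[of "2 * x"] unfolding X_le by linarith
  next
    have "\<Omega>.expectation X = real n / \<beta> * (\<Omega>.expectation ?R - ?m)"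
      using R_int by (simp add: X_def[abs_def] \<Omega>.prob_space)
    with tail(1) have "real n / \<beta> * (\<Omega>.expectation ?R - ?m) \<le> 0" by simp
    moreover have "0 < real n / \<beta>" using n_pos \<beta>_pos by simp
    ultimately show "\<Omega>.expectation ?R \<le> ?m" unfolding mult_le_0_iff by linarith
  qed
qed

end
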